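(* Let $p$ be a prime number, let $f\in R_2^{(p)}=\mathbb{F}_p[u_1^{\pm1},u_2^{\pm1}]$ be irreducible, and assume that $\mathscr{N}(f)$, the convex hull of the support $S(f)$ of $f$, is an $R$-gon. Let $\alpha$ be the algebraic $\mathbb{Z}^2$-action on the compact dual group of $R_2^{(p)}/\langle f\rangle$. Then the order of mixing $\mathscr{M}(\alpha)$ satisfies $$R-1\le \mathscr{M}(\alpha)<|S(f)|.$$
   Context: Ring and polynomial. $R_2^{(p)}=\mathbb{F}_p[u_1^{\pm1},u_2^{\pm1}]$ is the ring of Laurent polynomials in two commuting variables over $\mathbb{F}_p=\mathbb{Z}/p\mathbb{Z}$, and $\langle f\rangle=f\cdot R_2^{(p)}$. For $\mathbf{n}=(n_1,n_2)\in\mathbb{Z}^2$ write $u^{\mathbf{n}}=u_1^{n_1}u_2^{n_2}$. Writing $f=\sum_{\mathbf{n}\in\mathbb{Z}^2}c_f(\mathbf{n})u^{\mathbf{n}}$ with $c_f(\mathbf{n})\in\mathbb{F}_p$ (all but finitely many zero), the support of $f$ is $S(f)=\{\mathbf{n}\in\mathbb{Z}^2 : c_f(\mathbf{n})\neq 0\}$, and $\mathscr{N}(f)$ is the convex hull of $S(f)$, a convex polygon. An $R$-gon is a convex polygon with exactly $R$ vertices (equivalently $R$ faces, where the faces of a polygon are its edges). The action. Let $M=R_2^{(p)}/\langle f\rangle$, a countable discrete abelian group, and let $X=\widehat{M}$ be its compact Pontryagin dual with Haar probability measure $\mu$ on its Borel $\sigma$-algebra $\mathcal{S}$. For $\mathbf{n}\in\mathbb{Z}^2$,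 $\alpha^{\mathbf{n}}$ is the continuous automorphism of $X$ dual to the automorphism $m\mapsto u^{\mathbf{n}}m$ of $M$. Mixing. For $r\ge 1$, the action $\alpha$ is mixing of order $r$ if for every sequence $(\mathbf{n}_1^{(j)},\dots,\mathbf{n}_r^{(j)})_{j\ge1}$ of $r$-tuples of elements of $\mathbb{Z}^2$ with $\mathbf{n}_s^{(j)}-\mathbf{n}_t^{(j)}\to\infty$ as $j\to\infty$ for every $s\neq t$, and for all $A_1,\dots,A_r\in\mathcal{S}$, $$\lim_{j\to\infty}\mu\left(\alpha^{-\mathbf{n}_1^{(j)}}(A_1)\cap\dots\cap\alpha^{-\mathbf{n}_r^{(j)}}(A_r)\right)=\mu(A_1)\cdots\mu(A_r).$$ The order of mixing $\mathscr{M}(\alpha)$ is the largest $r$ for which $\alpha$ is mixing of order $r$ (if this is finite). *)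

theory Defs
  imports
    "HOL-Probability.Probability"
    "HOL-Algebra.Algebraic_Closure_Type"
    "HOL-Library.Poly_Mapping"
    "HOL-Library.Product_Plus"
    "HOL-Library.Extended_Nat"
    "Berlekamp_Zassenhaus.Finite_Field"
begin

text \<open>
  Laurent polynomials in two commuting variables over the prime field \<open>'p mod_ring\<close>, the integers
  modulo the prime \<open>CARD('p)\<close>: finitely supported functions \<open>n \<mapsto> c\<^sub>f(n)\<close> on
  \<open>int \<times> int\<close> with convolution as multiplication. The support \<open>S(f)\<close> is \<open>Poly_Mapping.keys f\<close>.
\<close>

type_synonym 'p laurent = "(int \<times> int) \<Rightarrow>\<^sub>0 'p mod_ring"

abbreviation laurent_ring :: "'p::prime_card laurent ring" where
  "laurent_ring \<equiv> ring_of_type_algebra"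

definition laurent_monom :: "int \<times> int \<Rightarrow> 'p::prime_card laurent" where
  "laurent_monom n = Poly_Mapping.single n 1"

definition newton_polygon :: "'p::prime_card laurent \<Rightarrow> (real \<times> real) set" where
  "newton_polygon f =
     convex hull ((\<lambda>(a, b). (real_of_int a, real_of_int b)) ` Poly_Mapping.keys f)"

text \<open>The vertices of a polygon are its extreme points. A segment counts as a polygon, with two
  vertices, so that every \<open>newton_polygon f\<close> is a polygon.\<close>

definition is_gon :: "nat \<Rightarrow> (real \<times> real) set \<Rightarrow> bool" where
  "is_gon R P \<longleftrightarrow> polytope P \<and> card {v. v extreme_point_of P} = R"


text \<open>
  The Pontryagin dual of a discrete abelian group \<open>G\<close>: its homomorphisms to the unit circle, made
  extensional so that equality of characters is equality on \<open>carrier G\<close>. As \<open>G\<close> is discrete, the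
  compact-open topology is the topology of pointwise convergence.
\<close>

definition circle_group :: "complex monoid" where
  "circle_group = \<lparr>carrier = sphere 0 1, mult = (*), one = 1\<rparr>"

definition dual_group :: "('a, 'b) monoid_scheme \<Rightarrow> ('a \<Rightarrow> complex) monoid" where
  "dual_group G =
     \<lparr>carrier = hom G circle_group \<inter> extensional (carrier G),
      mult = (\<lambda>x y. \<lambda>m\<in>carrier G. x m \<otimes>\<^bsub>circle_group\<^esub> y m),
      one = (\<lambda>m\<in>carrier G. \<one>\<^bsub>circle_group\<^esub>)\<rparr>"

definition dual_topology :: "('a, 'b) monoid_scheme \<Rightarrow> ('a \<Rightarrow> complex) topology" where
  "dual_topology G =
     subtopology (product_topology (\<lambda>_. top_of_set (carrier circle_group)) (carrier G))
       (carrier (dual_group G))"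

definition dual_map ::
    "('a, 'b) monoid_scheme \<Rightarrow> ('a \<Rightarrow> 'a) \<Rightarrow> ('a \<Rightarrow> complex) \<Rightarrow> ('a \<Rightarrow> complex)" where
  "dual_map G \<phi> x = (\<lambda>m\<in>carrier G. x (\<phi> m))"

text \<open>Regularity is not required: a Borel probability measure on a compact metrizable space, such as
  the dual of a countable discrete group, is regular.\<close>

definition is_haar_prob :: "('x, 'b) monoid_scheme \<Rightarrow> 'x topology \<Rightarrow> 'x measure \<Rightarrow> bool" where
  "is_haar_prob G T \<mu> \<longleftrightarrow>
     prob_space \<mu> \<and>
     space \<mu> = carrier G \<and>
     sets \<mu> = sigma_sets (carrier G) {U. openin T U} \<and>
     (\<forall>g\<in>carrier G. \<forall>A\<in>sets \<mu>. emeasure \<mu> (g <#\<^bsub>G\<^esub> A) = emeasure \<mu> A)"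


definition quot_ring :: "'p::prime_card laurent \<Rightarrow> 'p laurent set ring" where
  "quot_ring f = laurent_ring Quot (PIdl\<^bsub>laurent_ring\<^esub> f)"

abbreviation quot_group :: "'p::prime_card laurent \<Rightarrow> 'p laurent set monoid" where
  "quot_group f \<equiv> add_monoid (quot_ring f)"

definition monom_mult ::
    "'p::prime_card laurent \<Rightarrow> int \<times> int \<Rightarrow> 'p laurent set \<Rightarrow> 'p laurent set" where
  "monom_mult f n m =
     (PIdl\<^bsub>laurent_ring\<^esub> f +>\<^bsub>laurent_ring\<^esub> laurent_monom n) \<otimes>\<^bsub>quot_ring f\<^esub> m"

definition alg_action ::
    "'p::prime_card laurent \<Rightarrow> int \<times> int \<Rightarrow>
     ('p laurent set \<Rightarrow> complex) \<Rightarrow> ('p laurent set \<Rightarrow> complex)" where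
  "alg_action f n = dual_map (quot_group f) (monom_mult f n)"


text \<open>Convergence to infinity in the discrete group \<open>int \<times> int\<close> means eventually leaving every
  finite set, i.e. convergence along \<open>cofinite\<close>.\<close>

definition mixing_of_order ::
    "'x measure \<Rightarrow> (int \<times> int \<Rightarrow> 'x \<Rightarrow> 'x) \<Rightarrow> nat \<Rightarrow> bool" where
  "mixing_of_order \<mu> \<alpha> r \<longleftrightarrow>
     (\<forall>(n :: nat \<Rightarrow> nat \<Rightarrow> int \<times> int) (A :: nat \<Rightarrow> 'x set).
        (\<forall>s\<in>{1..r}. \<forall>t\<in>{1..r}. s \<noteq> t \<longrightarrow>
           filterlim (\<lambda>j. n j s - n j t) cofinite sequentially) \<longrightarrow>
        (\<forall>s\<in>{1..r}. A s \<in> sets \<mu>) \<longrightarrow>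
        (\<lambda>j. measure \<mu> (\<Inter>s\<in>{1..r}. \<alpha> (- n j s) ` A s))
          \<longlonglongrightarrow> (\<Prod>s\<in>{1..r}. measure \<mu> (A s)))"

text \<open>The largest order of mixing, or \<open>\<infinity>\<close> if there is no largest one.\<close>

definition mixing_order :: "'x measure \<Rightarrow> (int \<times> int \<Rightarrow> 'x \<Rightarrow> 'x) \<Rightarrow> enat" where
  "mixing_order \<mu> \<alpha> = Sup {enat r | r. r \<ge> 1 \<and> mixing_of_order \<mu> \<alpha> r}"

end

theory Submission
  imports Defs
begin

text \<open>Write \<open>u\<^sup>n\<close> for the monomial \<open>Poly_Mapping.single n 1\<close>. By Fourier analysis on the compact group \<open>chars f\<close>,
mixing along shifts \<open>n j 1, \<dots>, n j r\<close> is a statement about the dual module: it holds as soon as no fixed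
\<open>\<gamma> 1, \<dots>, \<gamma> r\<close>, not all divisible by \<open>f\<close>, satisfy \<open>f dvd (\<Sum>s. u^(n j s) * \<gamma> s)\<close> for infinitely many \<open>j\<close>.
The theorem is thus about vanishing sums of monomial translates modulo \<open>f\<close>.

\<^bold>\<open>Lower bound.\<close> Let \<open>w\<close> be an edge vector of the Newton polygon and call \<open>height w\<close> the linear functional
that the polygon maximises along that edge. The key fact (\<open>vanishing_sum_top_twice\<close>) is that in a sum
of terms \<open>m\<^sub>t\<close> times \<open>u\<close> to the power \<open>n\<^sub>t\<close> that is divisible by \<open>f\<close>, but whose \<open>m\<^sub>t\<close> are not divisible by \<open>f\<close>, the greatest height of the
\<open>n\<^sub>t\<close> is attained twice, up to a constant that does not depend on the \<open>n\<^sub>t\<close>. Classically this is the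
ultrametric inequality for a place of the function field of the curve \<open>f = 0\<close> belonging to the edge. The
proof here uses elimination instead of places: some nonzero combination \<open>d = g f + h m\<^sub>s\<close> involves a
single variable, one on whose powers the height is injective. If \<open>n\<^sub>s\<close> were far higher than all
the other \<open>n\<^sub>t\<close>, then modulo \<open>f\<close> the polynomial \<open>d\<close> would be congruent to terms of very small height;
so some multiple of \<open>f\<close> would have a single monomial of greatest height, whereas every
nonzero multiple of \<open>f\<close> has at least two, because \<open>f\<close> has two of them on the edge.

A segment leaves only sums of a single term to exclude, so let \<open>R \<ge> 3\<close>. Then each of the \<open>R\<close> edges provides two indices \<open>s \<noteq> t\<close> for which \<open>n\<^sub>t - n\<^sub>s\<close> is long, nearly parallel to the edge,
and both of nearly greatest height. Roughly, the convex hull of the \<open>n\<^sub>t\<close> has edges in all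
\<open>R\<close> directions, so it has at least \<open>R\<close> vertices. Precisely, sending an edge to the first index of its
pair, in counterclockwise order, is injective (\<open>card_le_of_nearly_attained_directions\<close>).
Hence fewer than \<open>R\<close> translates admit no such relations (\<open>eventually_no_relation\<close>).

\<^bold>\<open>Upper bound.\<close> In characteristic \<open>p\<close> the power \<open>f ^ (p ^ j)\<close> has the support \<open>p\<^sup>j \<cdot> S(f)\<close>. Evaluated
at a character this is a multiplicative relation between the coordinates \<open>x(u\<^sup>k)\<close> for \<open>k \<in> p\<^sup>j \<cdot> S(f)\<close>: if all but
one of them equal 1, then so does the last. This dependence persists for all \<open>j\<close>, although the
points of \<open>p\<^sup>j \<cdot> S(f)\<close> move apart, and it contradicts mixing of every order \<open>r \<ge> card (S(f))\<close>.\<close>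

section \<open>Elimination of a variable\<close>

text \<open>Over the fraction field of the coefficients the two polynomials are coprime; clearing denominators in a Bezout
identity gives a constant. To avoid fractions, pseudo-division replaces division: an element of least
degree in the ideal \<open>(F, M)\<close> divides \<open>F\<close> and \<open>M\<close> up to constants, and then primality of \<open>F\<close> produces a constant in the ideal.\<close>

lemma prime_poly_elimination:
  fixes F M :: "'a::idom_divide poly"
  assumes F: "prime_elem F" and M: "\<not> F dvd M"
  shows "\<exists>a b c. c \<noteq> 0 \<and> a * F + b * M = [:c:]"
proof -
  define I where "I = {a * F + b * M | a b. True}"
  have F_in: "F \<in> I" unfolding I_def by (rule CollectI) (metis add.right_neutral mult_1 mult_zero_left)
  have M_in: "M \<in> I" unfolding I_def by (rule CollectI) (metis add_0 mult_1 mult_zero_left)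
  have F0: "F \<noteq> 0" using F by auto
  have "\<exists>h. h \<in> I \<and> h \<noteq> 0 \<and> (\<forall>g. g \<in> I \<and> g \<noteq> 0 \<longrightarrow> Polynomial.degree h \<le> Polynomial.degree g)"
    using ex_has_least_nat[of "\<lambda>h. h \<in> I \<and> h \<noteq> 0" F Polynomial.degree] F_in F0 by auto
  then obtain h where h: "h \<in> I" "h \<noteq> 0" and least: "\<And>g. g \<in> I \<Longrightarrow> g \<noteq> 0 \<Longrightarrow> Polynomial.degree h \<le> Polynomial.degree g"
    by blast
  obtain u v where uv: "h = u * F + v * M" using h(1) unfolding I_def by blast
  have quot: "\<exists>c q. c \<noteq> 0 \<and> Polynomial.smult c g = h * q" if gI: "g \<in> I" and dh: "Polynomial.degree h \<noteq> 0" for g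
  proof -
    obtain c q where cq: "c \<noteq> 0" "Polynomial.smult c g = h * q + pseudo_mod g h"
      using pseudo_mod(1)[OF h(2), of g] by blast
    obtain x y where xy: "g = x * F + y * M" using gI unfolding I_def by blast
    have "pseudo_mod g h = Polynomial.smult c g - h * q" using cq(2) by (simp add: algebra_simps)
    also have "\<dots> = (Polynomial.smult c x - q * u) * F + (Polynomial.smult c y - q * v) * M"
      by (simp add: uv xy algebra_simps smult_add_right)
    finally have "pseudo_mod g h \<in> I" unfolding I_def by blast
    moreover have "pseudo_mod g h = 0 \<or> Polynomial.degree (pseudo_mod g h) < Polynomial.degree h"
      by (rule pseudo_mod(2)[OF h(2)])
    ultimately have "pseudo_mod g h = 0" using least by fastforce
    with cq show ?thesis by auto
  qed
  show ?thesis
  proof (cases "Polynomial.degree h = 0")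
    case True
    then obtain c where "h = [:c:]" by (rule degree_eq_zeroE)
    with h(2) uv show ?thesis by (metis pCons_0_0)
  next
    case False
    \<comment> \<open>By primality \<open>F\<close> divides \<open>h\<close> or its cofactor: then \<open>F\<close> or \<open>h\<close>, respectively, has degree 0.\<close>
    obtain c q where cq: "c \<noteq> 0" "Polynomial.smult c F = h * q" using quot[OF F_in False] by blast
    obtain c' q' where cq': "c' \<noteq> 0" "Polynomial.smult c' M = h * q'" using quot[OF M_in False] by blast
    have "F dvd h * q" using cq(2) by (metis dvd_smult dvd_refl)
    with F have "F dvd h \<or> F dvd q" by (simp add: prime_elem_dvd_mult_iff)
    then show ?thesis
    proof
      assume "F dvd h"
      hence "F dvd [:c':] * M" using cq'(2) by simp
      with F M have "F dvd [:c':]" using prime_elem_dvd_multD by blast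
      then have "Polynomial.degree F = 0" using cq'(1) by (metis degree_pCons_0 dvd_imp_degree_le le_zero_eq pCons_eq_0_iff)
      then obtain d where d: "F = [:d:]" by (rule degree_eq_zeroE)
      with F0 have "d \<noteq> 0" "1 * F + 0 * M = [:d:]" by auto
      then show ?thesis by blast
    next
      assume "F dvd q"
      then obtain q2 where "q = F * q2" by (elim dvdE)
      with cq(2) have "F * [:c:] = F * (h * q2)" by (simp add: mult_ac)
      hence "[:c:] = h * q2" using F0 mult_left_cancel by blast
      hence "h dvd [:c:]" by simp
      hence "Polynomial.degree h = 0" using cq(1) by (metis degree_pCons_0 dvd_imp_degree_le le_zero_eq pCons_eq_0_iff)
      with False show ?thesis by simp
    qed
  qed
qed

definition zscale :: "int \<Rightarrow> int \<times> int \<Rightarrow> int \<times> int" where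
  "zscale k a = (k * fst a, k * snd a)"

lemma single_power:
  "Poly_Mapping.single a (c :: 'b::comm_semiring_1) ^ n = Poly_Mapping.single (zscale (int n) a) (c ^ n)"
proof (induction n)
  case 0
  then show ?case by (simp add: zscale_def zero_prod_def[symmetric])
next
  case (Suc n)
  have "a + zscale (int n) a = zscale (int (Suc n)) a"
    by (cases a) (simp add: zscale_def algebra_simps)
  with Suc show ?case by (simp add: mult_single)
qed

lemma poly_mapping_sum_single:
  "(\<Sum>k\<in>Poly_Mapping.keys g. Poly_Mapping.single k (Poly_Mapping.lookup g k)) = g"
proof (rule poly_mapping_eqI)
  fix k
  show "Poly_Mapping.lookup (\<Sum>k\<in>Poly_Mapping.keys g. Poly_Mapping.single k (Poly_Mapping.lookup g k)) k
      = Poly_Mapping.lookup g k"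
    by (simp add: lookup_sum lookup_single when_def in_keys_iff sum.If_cases)
qed

lemma lookup_mult_group:
  fixes f g :: "'a::ab_group_add \<Rightarrow>\<^sub>0 'b::comm_semiring_0"
  shows "Poly_Mapping.lookup (f * g) k
    = (\<Sum>l\<in>Poly_Mapping.keys f. Poly_Mapping.lookup f l * Poly_Mapping.lookup g (k - l))"
proof -
  have "(\<Sum>q. Poly_Mapping.lookup g q when k = l + q) = Poly_Mapping.lookup g (k - l)" for l
  proof -
    have "(\<lambda>q. Poly_Mapping.lookup g q when k = l + q) = (\<lambda>q. Poly_Mapping.lookup g q when q = k - l)"
      by (auto simp: algebra_simps when_def fun_eq_iff)
    then show ?thesis by (simp only: Sum_any_when_equal)
  qed
  then have "Poly_Mapping.lookup (f * g) k
      = (\<Sum>l. Poly_Mapping.lookup f l * Poly_Mapping.lookup g (k - l))"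
    by (simp add: lookup_mult)
  also have "\<dots> = (\<Sum>l\<in>Poly_Mapping.keys f. Poly_Mapping.lookup f l * Poly_Mapping.lookup g (k - l))"
    by (rule Sum_any.expand_superset) (auto simp: in_keys_iff)
  finally show ?thesis .
qed

text \<open>A monomial that arises in only one way as a product of monomials of the factors cannot cancel.\<close>

lemma lookup_mult_unique:
  fixes f g :: "'a::ab_group_add \<Rightarrow>\<^sub>0 'b::comm_semiring_0"
  assumes "a \<in> Poly_Mapping.keys f"
    and "\<And>x y. x \<in> Poly_Mapping.keys f \<Longrightarrow> y \<in> Poly_Mapping.keys g \<Longrightarrow> x + y = a + b \<Longrightarrow> x = a"
  shows "Poly_Mapping.lookup (f * g) (a + b) = Poly_Mapping.lookup f a * Poly_Mapping.lookup g b"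
proof -
  have "Poly_Mapping.lookup f l * Poly_Mapping.lookup g (a + b - l) = 0"
    if "l \<in> Poly_Mapping.keys f" "l \<noteq> a" for l
    using assms(2)[of l "a + b - l"] that by (cases "a + b - l \<in> Poly_Mapping.keys g") (auto simp: in_keys_iff)
  then have "(\<Sum>l\<in>Poly_Mapping.keys f. Poly_Mapping.lookup f l * Poly_Mapping.lookup g (a + b - l))
     = (\<Sum>l\<in>{a}. Poly_Mapping.lookup f l * Poly_Mapping.lookup g (a + b - l))"
    using assms(1) by (intro sum.mono_neutral_right) auto
  then show ?thesis by (simp add: lookup_mult_group)
qed

text \<open>If \<open>w\<close> is an edge vector of a convex polygon traversed counterclockwise, then \<open>height w\<close> is the inner product
with the outward normal of that edge, so that the polygon attains its greatest height exactly there.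
It is also the determinant of \<open>x\<close> and \<open>w\<close>, so \<open>height w x = 0\<close> says that \<open>x\<close> and \<open>w\<close> are parallel.\<close>

section \<open>Monomials of greatest height\<close>

definition height :: "int \<times> int \<Rightarrow> int \<times> int \<Rightarrow> int" where
  "height w x = fst x * snd w - snd x * fst w"

definition idot :: "int \<times> int \<Rightarrow> int \<times> int \<Rightarrow> int" where
  "idot w x = fst w * fst x + snd w * snd x"

lemma height_add [simp]: "height w (x + y) = height w x + height w y"
  by (simp add: height_def algebra_simps)

lemma height_diff [simp]: "height w (x - y) = height w x - height w y"
  by (simp add: height_def algebra_simps)

lemma height_zscale [simp]: "height w (zscale k x) = k * height w x"
  by (simp add: height_def zscale_def algebra_simps)

lemma idot_add [simp]: "idot w (x + y) = idot w x + idot w y"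
  by (simp add: idot_def algebra_simps)

lemma height_idot_inj:
  assumes "w \<noteq> 0" "height w x = height w y" "idot w x = idot w y"
  shows "x = y"
proof -
  obtain a b where w: "w = (a, b)" by (cases w)
  obtain x1 x2 where x: "x = (x1, x2)" by (cases x)
  obtain y1 y2 where y: "y = (y1, y2)" by (cases y)
  have pos: "a * a + b * b \<noteq> 0" using assms(1) by (auto simp: w zero_prod_def sum_squares_eq_zero_iff)
  have 1: "(x1 - y1) * b - (x2 - y2) * a = 0" "a * (x1 - y1) + b * (x2 - y2) = 0"
    using assms(2,3) by (auto simp: height_def idot_def w x y algebra_simps)
  have "(a * a + b * b) * (x1 - y1) = b * ((x1 - y1) * b - (x2 - y2) * a) + a * (a * (x1 - y1) + b * (x2 - y2))"
    by (simp add: algebra_simps)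
  moreover have "(a * a + b * b) * (x2 - y2) = b * (a * (x1 - y1) + b * (x2 - y2)) - a * ((x1 - y1) * b - (x2 - y2) * a)"
    by (simp add: algebra_simps)
  ultimately have "(a * a + b * b) * (x1 - y1) = 0" "(a * a + b * b) * (x2 - y2) = 0" unfolding 1 by auto
  with pos have "x1 - y1 = 0" "x2 - y2 = 0" by (metis mult_eq_0_iff)+
  then show ?thesis by (simp add: x y)
qed

lemma finite_lex_max:
  fixes \<phi> \<psi> :: "'a \<Rightarrow> int"
  assumes "finite K" "K \<noteq> {}"
  obtains k where "k \<in> K" "\<And>x. x \<in> K \<Longrightarrow> \<phi> x < \<phi> k \<or> \<phi> x = \<phi> k \<and> \<psi> x \<le> \<psi> k"
proof -
  have argmax: "\<exists>k\<in>L. \<forall>x\<in>L. g x \<le> g k" if "finite L" "L \<noteq> {}" for L and g :: "'a \<Rightarrow> int"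
    using Max_in[of "g ` L"] Max_ge[of "g ` L"] that by fastforce
  obtain k1 where k1: "k1 \<in> K" "\<And>x. x \<in> K \<Longrightarrow> \<phi> x \<le> \<phi> k1"
    using argmax[OF assms, of \<phi>] by blast
  let ?L = "{x \<in> K. \<phi> x = \<phi> k1}"
  have "finite ?L" "?L \<noteq> {}" using assms k1 by auto
  then obtain k where k: "k \<in> ?L" "\<And>x. x \<in> ?L \<Longrightarrow> \<psi> x \<le> \<psi> k"
    using argmax[of ?L \<psi>] by blast
  show thesis
  proof (rule that[of k])
    show "k \<in> K" using k by simp
    show "\<phi> x < \<phi> k \<or> \<phi> x = \<phi> k \<and> \<psi> x \<le> \<psi> k" if "x \<in> K" for x
      using k1(2)[OF that] k(1) k(2)[of x] that by fastforce
  qed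
qed

text \<open>Ordering monomials by height first and by \<open>\<psi>\<close> second is compatible with multiplication and total, so the leading
monomials of the factors multiply to a monomial of the product.\<close>

lemma lookup_mult_lex_max:
  fixes f q :: "int \<times> int \<Rightarrow>\<^sub>0 'b::idom" and \<psi> :: "int \<times> int \<Rightarrow> int"
  assumes inj: "\<And>x y. height w x = height w y \<Longrightarrow> \<psi> x = \<psi> y \<Longrightarrow> x = y"
    and add: "\<And>x y. \<psi> (x + y) = \<psi> x + \<psi> y"
    and k: "k \<in> Poly_Mapping.keys f" "l \<in> Poly_Mapping.keys q"
    and kmax: "\<And>x. x \<in> Poly_Mapping.keys f \<Longrightarrow> height w x < height w k \<or> height w x = height w k \<and> \<psi> x \<le> \<psi> k"
    and lmax: "\<And>x. x \<in> Poly_Mapping.keys q \<Longrightarrow> height w x < height w l \<or> height w x = height w l \<and> \<psi> x \<le> \<psi> l"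
  shows "k + l \<in> Poly_Mapping.keys (f * q)"
proof -
  have "Poly_Mapping.lookup (f * q) (k + l) = Poly_Mapping.lookup f k * Poly_Mapping.lookup q l"
  proof (rule lookup_mult_unique[OF k(1)])
    fix x y assume x: "x \<in> Poly_Mapping.keys f" and y: "y \<in> Poly_Mapping.keys q" and eq: "x + y = k + l"
    have h: "height w x + height w y = height w k + height w l" using eq by (metis height_add)
    have p: "\<psi> x + \<psi> y = \<psi> k + \<psi> l" using eq by (metis add)
    show "x = k" by (rule inj) (use kmax[OF x] lmax[OF y] h p in linarith)+
  qed
  with k show ?thesis by (simp add: in_keys_iff)
qed

text \<open>The top of a product is the product of the tops.\<close>

text \<open>The part of greatest height of a product is the product of the parts of greatest height, and a product with a
factor that is not a monomial is not a monomial: breaking ties in the height by \<open>idot w\<close> in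
the two opposite ways gives two different leading monomials of \<open>f\<close>, hence of \<open>f * q\<close>.\<close>

lemma two_top_keys_mult:
  fixes f q :: "int \<times> int \<Rightarrow>\<^sub>0 'b::idom"
  assumes w: "w \<noteq> 0"
    and e: "e \<in> Poly_Mapping.keys f" "e' \<in> Poly_Mapping.keys f" "e \<noteq> e'" "height w e' = height w e"
    and top: "\<And>k. k \<in> Poly_Mapping.keys f \<Longrightarrow> height w k \<le> height w e"
    and q: "q \<noteq> 0"
  shows "\<exists>x\<in>Poly_Mapping.keys (f * q). \<exists>y\<in>Poly_Mapping.keys (f * q). x \<noteq> y \<and>
    height w y = height w x \<and> (\<forall>k\<in>Poly_Mapping.keys (f * q). height w k \<le> height w x)"
proof -
  let ?m = "\<lambda>x. - idot w x"
  have fin: "finite (Poly_Mapping.keys f)" "Poly_Mapping.keys f \<noteq> {}"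
    "finite (Poly_Mapping.keys q)" "Poly_Mapping.keys q \<noteq> {}" using e q by auto
  obtain k1 where k1: "k1 \<in> Poly_Mapping.keys f" 
    "\<And>x. x \<in> Poly_Mapping.keys f \<Longrightarrow> height w x < height w k1 \<or> height w x = height w k1 \<and> idot w x \<le> idot w k1"
    using finite_lex_max[OF fin(1,2), of "height w" "idot w"] by metis
  obtain k2 where k2: "k2 \<in> Poly_Mapping.keys f"
    "\<And>x. x \<in> Poly_Mapping.keys f \<Longrightarrow> height w x < height w k2 \<or> height w x = height w k2 \<and> ?m x \<le> ?m k2"
    using finite_lex_max[OF fin(1,2), of "height w" ?m] by metis
  obtain l1 where l1: "l1 \<in> Poly_Mapping.keys q" 
    "\<And>x. x \<in> Poly_Mapping.keys q \<Longrightarrow> height w x < height w l1 \<or> height w x = height w l1 \<and> idot w x \<le> idot w l1"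
    using finite_lex_max[OF fin(3,4), of "height w" "idot w"] by metis
  obtain l2 where l2: "l2 \<in> Poly_Mapping.keys q"
    "\<And>x. x \<in> Poly_Mapping.keys q \<Longrightarrow> height w x < height w l2 \<or> height w x = height w l2 \<and> ?m x \<le> ?m l2"
    using finite_lex_max[OF fin(3,4), of "height w" ?m] by metis
  have x: "k1 + l1 \<in> Poly_Mapping.keys (f * q)"
    by (rule lookup_mult_lex_max[OF height_idot_inj[OF w] idot_add k1(1) l1(1) k1(2) l1(2)])
  have y: "k2 + l2 \<in> Poly_Mapping.keys (f * q)"
  proof (rule lookup_mult_lex_max[where \<psi> = ?m, OF _ _ k2(1) l2(1) k2(2) l2(2)])
    show "x = y" if "height w x = height w y" "?m x = ?m y" for x y
      using height_idot_inj[OF w that(1)] that(2) by simp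
  qed simp
  have hk: "height w k1 = height w e" "height w k2 = height w e"
    using k1(2)[OF e(1)] k2(2)[OF e(1)] top[OF k1(1)] top[OF k2(1)] by auto
  have hl: "height w l2 = height w l1"
    using l1(2)[OF l2(1)] l2(2)[OF l1(1)] by auto
  have "idot w e \<noteq> idot w e'" using height_idot_inj[OF w, of e e'] e by auto
  moreover have "idot w e \<le> idot w k1" "idot w e' \<le> idot w k1" "idot w k2 \<le> idot w e" "idot w k2 \<le> idot w e'"
    using k1(2)[OF e(1)] k1(2)[OF e(2)] k2(2)[OF e(1)] k2(2)[OF e(2)] hk e(4) by auto
  ultimately have "idot w k2 < idot w k1" by linarith
  moreover have "idot w l2 \<le> idot w l1" using l1(2)[OF l2(1)] hl by auto
  ultimately have "idot w (k2 + l2) < idot w (k1 + l1)" by simp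
  then have ne: "k1 + l1 \<noteq> k2 + l2" by (metis less_irrefl)
  show ?thesis
  proof (rule bexI[OF _ x], rule bexI[OF _ y], intro conjI ballI ne)
    show "height w (k2 + l2) = height w (k1 + l1)" using hk hl by simp
    fix k assume "k \<in> Poly_Mapping.keys (f * q)"
    then obtain a b where "k = a + b" "a \<in> Poly_Mapping.keys f" "b \<in> Poly_Mapping.keys q"
      using keys_mult[of f q] by blast
    then show "height w k \<le> height w (k1 + l1)"
      using top[of a] hk l1(2)[of b] by fastforce
  qed
qed


lemma bounded_on_finite:
  fixes g :: "'a \<Rightarrow> int"
  assumes "finite A"
  shows "\<exists>B. 0 \<le> B \<and> (\<forall>x\<in>A. \<bar>g x\<bar> \<le> B)"
proof (intro exI conjI ballI)
  show "0 \<le> (\<Sum>x\<in>A. \<bar>g x\<bar>)" by (simp add: sum_nonneg)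
  show "\<bar>g x\<bar> \<le> (\<Sum>x\<in>A. \<bar>g x\<bar>)" if "x \<in> A" for x
    using assms that by (intro member_le_sum) auto
qed

text \<open>Evaluation of a polynomial in two variables at \<open>u\<^sup>a\<close> (for the variable of the coefficients) and \<open>u\<^sup>b\<close> (for the main variable).
It carries unique factorisation and elimination over from polynomials to Laurent polynomials.\<close>

section \<open>From polynomials to Laurent polynomials\<close>

definition eval2 :: "int \<times> int \<Rightarrow> int \<times> int \<Rightarrow> 'p::prime_card mod_ring poly poly \<Rightarrow> 'p laurent" where
  "eval2 a b P = poly (map_poly (\<lambda>c. poly (map_poly (Poly_Mapping.single 0) c) (Poly_Mapping.single a 1)) P)
     (Poly_Mapping.single b 1)"

lemma comm_ring_hom_eval:
  assumes "comm_ring_hom h"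
  shows "comm_ring_hom (\<lambda>p. poly (map_poly h p) x)"
proof -
  interpret h: comm_ring_hom h by fact
  interpret m: map_poly_comm_ring_hom h ..
  show ?thesis
    by unfold_locales (simp_all add: m.hom_add m.hom_mult)
qed

lemma comm_ring_hom_single: "comm_ring_hom (Poly_Mapping.single (0::'a::comm_monoid_add) :: 'b::comm_ring_1 \<Rightarrow> _)"
  by unfold_locales (simp_all add: single_add mult_single)

lemma comm_ring_hom_eval2: "comm_ring_hom (eval2 a b)"
  unfolding eval2_def [abs_def]
  by (intro comm_ring_hom_eval comm_ring_hom_single)

lemma single_eq_0: "Poly_Mapping.single k c = 0 \<longleftrightarrow> c = 0"
  by (metis lookup_single_eq lookup_zero single_zero)

lemma eval2_const:
  "eval2 a b [:c:] = (\<Sum>i\<le>Polynomial.degree c. Poly_Mapping.single (zscale (int i) a) (Polynomial.coeff c i))"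
proof -
  have "eval2 a b [:c:] = poly (map_poly (Poly_Mapping.single 0) c) (Poly_Mapping.single a 1)"
    unfolding eval2_def by (cases "c = 0") (auto simp: map_poly_pCons)
  also have "\<dots> = (\<Sum>i\<le>Polynomial.degree c. Poly_Mapping.single (zscale (int i) a) (Polynomial.coeff c i))"
  proof (cases "c = 0")
    case False
    then show ?thesis
      by (simp add: poly_altdef degree_map_poly single_eq_0 coeff_map_poly single_power mult_single)
  qed simp
  finally show ?thesis .
qed

lemma eval2_monom:
  "eval2 a b (Polynomial.monom (Polynomial.monom c i) j)
    = Poly_Mapping.single (zscale (int i) a + zscale (int j) b) c"
  by (simp add: eval2_def map_poly_monom poly_monom single_power mult_single)

text \<open>Multiplying by a high power of both variables makes all exponents nonnegative. The vectors \<open>a\<close> and \<open>b\<close> are the two unit vectors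
in either order, since either variable may have to be eliminated.\<close>

lemma eval2_surj_up_to_shift:
  fixes g :: "'p::prime_card laurent"
  assumes "(a, b) = ((1, 0), (0, 1)) \<or> (a, b) = ((0, 1), (1, 0))"
  obtains P N where "eval2 a b P = Poly_Mapping.single N 1 * g"
proof -
  interpret comm_ring_hom "eval2 a b :: _ \<Rightarrow> 'p laurent" by (rule comm_ring_hom_eval2)
  obtain B1 where B1: "0 \<le> B1" "\<And>x. x \<in> Poly_Mapping.keys g \<Longrightarrow> \<bar>fst x\<bar> \<le> B1"
    using bounded_on_finite[OF finite_keys[of g], of fst] by metis
  obtain B2 where B2: "0 \<le> B2" "\<And>x. x \<in> Poly_Mapping.keys g \<Longrightarrow> \<bar>snd x\<bar> \<le> B2"
    using bounded_on_finite[OF finite_keys[of g], of snd] by metis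
  have "\<exists>i j. zscale (int i) a + zscale (int j) b = (B1, B2) + k" if "k \<in> Poly_Mapping.keys g" for k
  proof -
    have nn: "0 \<le> B1 + fst k" "0 \<le> B2 + snd k" using B1(2)[OF that] B2(2)[OF that] by auto
    from assms show ?thesis
    proof
      assume "(a, b) = ((1, 0), (0, 1))"
      then show ?thesis using nn
        by (intro exI[of _ "nat (B1 + fst k)"] exI[of _ "nat (B2 + snd k)"]) (auto simp: zscale_def prod_eq_iff)
    next
      assume "(a, b) = ((0, 1), (1, 0))"
      then show ?thesis using nn
        by (intro exI[of _ "nat (B2 + snd k)"] exI[of _ "nat (B1 + fst k)"]) (auto simp: zscale_def prod_eq_iff)
    qed
  qed
  then obtain i j where ij: "\<And>k. k \<in> Poly_Mapping.keys g \<Longrightarrow> zscale (int (i k)) a + zscale (int (j k)) b = (B1, B2) + k"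
    by metis
  let ?c = "Poly_Mapping.lookup g"
  have "eval2 a b (\<Sum>k\<in>Poly_Mapping.keys g. Polynomial.monom (Polynomial.monom (?c k) (i k)) (j k))
      = (\<Sum>k\<in>Poly_Mapping.keys g. Poly_Mapping.single ((B1, B2) + k) (?c k))"
    by (simp add: hom_sum eval2_monom ij)
  also have "\<dots> = Poly_Mapping.single (B1, B2) 1 * (\<Sum>k\<in>Poly_Mapping.keys g. Poly_Mapping.single k (?c k))"
    by (simp add: sum_distrib_left mult_single)
  also have "\<dots> = Poly_Mapping.single (B1, B2) 1 * g" by (simp add: poly_mapping_sum_single)
  finally show thesis by (rule that)
qed

text \<open>The image of a factorisation of \<open>P\<close> into primes is a factorisation of an associate of the irreducible \<open>f\<close>, so all
images but one are units. This replaces unique factorisation in the target ring.\<close>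

lemma irreducible_dvd_hom_prime:
  fixes f :: "'b::comm_semiring_1" and S :: "'a::{factorial_semiring} \<Rightarrow> 'b"
  assumes hom: "\<And>x y. S (x * y) = S x * S y" "S 1 = 1" "S 0 = 0"
    and f: "Factorial_Ring.irreducible f" and "f dvd S P" "S P dvd f"
  shows "\<exists>Q. prime_elem Q \<and> f dvd S Q"
  using f assms(5,6)
proof (induction P arbitrary: f rule: prime_divisors_induct)
  case zero
  then show ?case by (auto simp: hom Factorial_Ring.irreducible_def)
next
  case (unit x)
  then obtain y where "1 = x * y" by (elim dvdE)
  then have "S x dvd 1" using hom by (metis dvd_triv_left)
  with unit have "f dvd 1" using dvd_trans by blast
  with unit show ?case by (auto simp: Factorial_Ring.irreducible_def)
next
  case (factor p x)
  from factor.prems obtain k where k: "f = S p * (S x * k)" by (auto simp: hom mult_ac elim!: dvdE)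
  with factor.prems(1) have "S p dvd 1 \<or> S x * k dvd 1" by (rule Factorial_Ring.irreducibleD)
  then show ?case
  proof
    assume "S p dvd 1"
    then obtain u where u: "1 = S p * u" by (elim dvdE)
    have "S x = S (p * x) * u" by (metis hom(1) mult.assoc mult.commute mult_1 u)
    with factor.prems(2) have "f dvd S x" by (metis dvd_mult2)
    moreover have "S x dvd f" unfolding k by (simp add: mult_ac)
    ultimately show ?thesis using factor by blast
  next
    assume "S x * k dvd 1"
    then obtain u where u: "1 = S x * k * u" by (elim dvdE)
    have "S p = f * u" unfolding k by (metis mult.assoc mult.commute mult_1 u)
    then have "f dvd S p" by simp
    with factor show ?thesis using prime_imp_prime_elem by blast
  qed
qed

text \<open>A nonzero combination of \<open>f\<close> and \<open>m\<close> that involves only the variable \<open>u\<^sup>a\<close>. It comes from \<open>prime_poly_elimination\<close>, applied to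
a prime polynomial whose image is a multiple of \<open>f\<close>.\<close>

lemma laurent_elimination:
  fixes f m :: "'p::prime_card laurent" and a b :: "int \<times> int"
  assumes ab: "(a, b) = ((1, 0), (0, 1)) \<or> (a, b) = ((0, 1), (1, 0))"
    and f: "Factorial_Ring.irreducible f" and m: "\<not> f dvd m"
  obtains d g h where "d \<noteq> 0" "d = g * f + h * m"
    "\<And>k. k \<in> Poly_Mapping.keys d \<Longrightarrow> \<exists>i. k = zscale i a"
proof -
  interpret comm_ring_hom "eval2 a b :: _ \<Rightarrow> 'p laurent" by (rule comm_ring_hom_eval2)
  obtain P N where P: "eval2 a b P = Poly_Mapping.single N 1 * f" using eval2_surj_up_to_shift[OF ab, of f] .
  obtain M L where M: "eval2 a b M = Poly_Mapping.single L 1 * m" using eval2_surj_up_to_shift[OF ab, of m] .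
  have cancel: "x dvd y" if "x dvd Poly_Mapping.single K 1 * y" for x y :: "'p laurent" and K
  proof -
    have "y = Poly_Mapping.single (- K) 1 * (Poly_Mapping.single K 1 * y)"
      by (simp add: mult_single mult.assoc[symmetric])
    with that show ?thesis by (metis dvd_mult)
  qed
  have "eval2 a b P dvd f"
    by (rule cancel[of _ N]) (simp add: P)
  then obtain Q where Q: "prime_elem Q" "f dvd eval2 a b Q"
    using irreducible_dvd_hom_prime[of "eval2 a b" f P] f P by (auto simp: hom_mult)
  have "\<not> Q dvd M"
  proof
    assume "Q dvd M"
    then have "eval2 a b Q dvd eval2 a b M" by (rule hom_dvd)
    with Q(2) M have "f dvd Poly_Mapping.single L 1 * m" by (metis dvd_trans)
    with m show False using cancel by blast
  qed
  from prime_poly_elimination[OF Q(1) this] obtain x y c where c: "c \<noteq> 0" "x * Q + y * M = [:c:]" by blast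
  obtain q where q: "eval2 a b Q = f * q" using Q(2) by (elim dvdE)
  have d: "eval2 a b [:c:] = (eval2 a b x * q) * f + (eval2 a b y * Poly_Mapping.single L 1) * m"
    unfolding c(2)[symmetric] by (simp add: hom_add hom_mult q M mult_ac)
  have inj: "zscale (int i) a = zscale (int j) a \<longleftrightarrow> i = j" for i j
    using ab by (auto simp: zscale_def)
  have "Poly_Mapping.lookup (eval2 a b [:c:]) (zscale (int (Polynomial.degree c)) a) = Polynomial.lead_coeff c"
    by (simp add: eval2_const lookup_sum lookup_single when_def inj sum.delta)
  with c(1) have "eval2 a b [:c:] \<noteq> 0" by (metis leading_coeff_0_iff lookup_zero)
  moreover have "\<exists>i. k = zscale i a" if "k \<in> Poly_Mapping.keys (eval2 a b [:c:])" for k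
    using that keys_sum[of "\<lambda>i. Poly_Mapping.single (zscale (int i) a) (Polynomial.coeff c i)" "{..Polynomial.degree c}"]
    by (auto simp: eval2_const split: if_splits)
  ultimately show thesis using d that by blast
qed


section \<open>Vanishing sums of translates\<close>

text \<open>Two of the exponents of a vanishing sum nearly attain the greatest height: this is the elementary form of the ultrametric inequality at a
place of the curve \<open>f = 0\<close>. The constant \<open>C\<close> depends on the coefficients \<open>m\<close> but not on the exponents \<open>n\<close>.\<close>

lemma vanishing_sum_top_twice:
  fixes f :: "'p::prime_card laurent" and m :: "'i \<Rightarrow> 'p laurent"
  assumes f: "Factorial_Ring.irreducible f" and w: "w \<noteq> 0"
    and e: "e \<in> Poly_Mapping.keys f" "e' \<in> Poly_Mapping.keys f" "e \<noteq> e'" "height w e' = height w e"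
    and top: "\<And>k. k \<in> Poly_Mapping.keys f \<Longrightarrow> height w k \<le> height w e"
    and T: "finite T" and m: "\<And>t. t \<in> T \<Longrightarrow> \<not> f dvd m t"
  shows "\<exists>C. \<forall>n. f dvd (\<Sum>t\<in>T. Poly_Mapping.single (n t) 1 * m t) \<longrightarrow>
           (\<forall>s\<in>T. \<exists>t\<in>T - {s}. height w (n s) \<le> height w (n t) + C)"
proof -
  \<comment> \<open>Choose the variable to keep so that its powers have distinct heights.\<close>
  obtain a b :: "int \<times> int" where ab: "(a, b) = ((1, 0), (0, 1)) \<or> (a, b) = ((0, 1), (1, 0))"
    and ha: "height w a \<noteq> 0"
  proof (cases "snd w = 0")
    case True
    with w have "height w (0, 1) \<noteq> 0" by (cases w) (auto simp: height_def zero_prod_def)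
    then show thesis using that[of "(0, 1)" "(1, 0)"] by simp
  next
    case False
    then have "height w (1, 0) \<noteq> 0" by (simp add: height_def)
    then show thesis using that[of "(1, 0)" "(0, 1)"] by simp
  qed
  have "\<exists>d g h. d \<noteq> 0 \<and> d = g * f + h * m t \<and> (\<forall>k\<in>Poly_Mapping.keys d. \<exists>i. k = zscale i a)" if "t \<in> T" for t
    using laurent_elimination[OF ab f m[OF that]] by metis
  then obtain d g h where d: "\<And>t. t \<in> T \<Longrightarrow> d t \<noteq> 0" "\<And>t. t \<in> T \<Longrightarrow> d t = g t * f + h t * m t"
    "\<And>t k. t \<in> T \<Longrightarrow> k \<in> Poly_Mapping.keys (d t) \<Longrightarrow> \<exists>i. k = zscale i a" by metis
  have "finite ((\<Union>s\<in>T. Poly_Mapping.keys (d s)) \<union> (\<Union>s\<in>T. \<Union>t\<in>T. Poly_Mapping.keys (h s * m t)))"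
    using T by auto
  from bounded_on_finite[OF this, of "height w"] obtain B where
    B0: "\<forall>k\<in>(\<Union>s\<in>T. Poly_Mapping.keys (d s)) \<union> (\<Union>s\<in>T. \<Union>t\<in>T. Poly_Mapping.keys (h s * m t)).
      \<bar>height w k\<bar> \<le> B"
    by metis
  have B: "\<bar>height w k\<bar> \<le> B" if "s \<in> T" "k \<in> Poly_Mapping.keys (d s)" for s k
    using that by (intro B0[rule_format]) auto
  have B': "\<bar>height w k\<bar> \<le> B" if "s \<in> T" "t \<in> T" "k \<in> Poly_Mapping.keys (h s * m t)" for s t k
    using that by (intro B0[rule_format]) auto
  show ?thesis
  proof (intro exI[of _ "2 * B"] allI impI ballI, rule ccontr)
    fix n s
    assume dvd: "f dvd (\<Sum>t\<in>T. Poly_Mapping.single (n t) 1 * m t)" and s: "s \<in> T"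
      and neg: "\<not> (\<exists>t\<in>T - {s}. height w (n s) \<le> height w (n t) + 2 * B)"
    obtain r where r: "(\<Sum>t\<in>T. Poly_Mapping.single (n t) 1 * m t) = f * r" using dvd by (elim dvdE)
    \<comment> \<open>After normalising the top exponent to 0, the contribution \<open>E\<close> of the other terms lies below all of \<open>d s\<close>.\<close>
    define E where "E = (\<Sum>t\<in>T - {s}. Poly_Mapping.single (n t - n s) 1 * (h s * m t))"
    define q where "q = g s + Poly_Mapping.single (- n s) 1 * h s * r"
    have "Poly_Mapping.single (- n s) 1 * h s * (f * r) = h s * m s + E"
    proof -
      have "Poly_Mapping.single (- n s) 1 * h s * (f * r)
          = (\<Sum>t\<in>T. Poly_Mapping.single (n t - n s) 1 * (h s * m t))"
        unfolding r[symmetric] sum_distrib_left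
      proof (rule sum.cong[OF refl])
        fix t
        have "Poly_Mapping.single (- n s) 1 * h s * (Poly_Mapping.single (n t) 1 * m t)
            = (Poly_Mapping.single (- n s) 1 * Poly_Mapping.single (n t) 1) * (h s * m t)"
          by (simp add: mult_ac)
        then show "Poly_Mapping.single (- n s) 1 * h s * (Poly_Mapping.single (n t) 1 * m t)
            = Poly_Mapping.single (n t - n s) 1 * (h s * m t)"
          by (simp add: mult_single)
      qed
      also have "\<dots> = h s * m s + E"
        unfolding E_def by (subst sum.remove[OF T s]) simp
      finally show ?thesis .
    qed
    moreover have "f * q = g s * f + Poly_Mapping.single (- n s) 1 * h s * (f * r)"
      unfolding q_def by (simp add: distrib_left mult_ac)
    ultimately have fq: "f * q = d s + E"
      using d(2)[OF s] by (simp only: add.assoc)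
    have E: "height w k < - B" if "k \<in> Poly_Mapping.keys E" for k
    proof -
      have "k \<in> (\<Union>t\<in>T - {s}. Poly_Mapping.keys (Poly_Mapping.single (n t - n s) 1 * (h s * m t)))"
        using that unfolding E_def by (rule subsetD[OF keys_sum])
      then obtain t where t: "t \<in> T" "t \<noteq> s" "k \<in> Poly_Mapping.keys (Poly_Mapping.single (n t - n s) 1 * (h s * m t))"
        by auto
      then obtain u l where "k = u + l" "u \<in> Poly_Mapping.keys (Poly_Mapping.single (n t - n s) (1::'p mod_ring))"
        and l2: "l \<in> Poly_Mapping.keys (h s * m t)"
        using keys_mult[of "Poly_Mapping.single (n t - n s) 1" "h s * m t"] by blast
      then have l: "k = (n t - n s) + l" by (simp split: if_splits)
      have "height w l \<le> B" using B'[OF s t(1) l2] by linarith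
      moreover have "height w (n t) + 2 * B < height w (n s)" using neg t(1,2) by (meson DiffI not_le singletonD)
      ultimately show ?thesis unfolding l height_add height_diff by linarith
    qed
    have in_d: "k \<in> Poly_Mapping.keys (d s)" if "k \<in> Poly_Mapping.keys (f * q)" "- B \<le> height w k" for k
    proof -
      have "k \<notin> Poly_Mapping.keys E" using E[of k] that(2) by linarith
      with that(1) show ?thesis unfolding fq by (simp add: in_keys_iff lookup_add)
    qed
    \<comment> \<open>The top monomial of \<open>d s\<close> survives in \<open>f * q\<close>, and it is the only one of its height.\<close>
    obtain k0 where k0: "k0 \<in> Poly_Mapping.keys (d s)"
      "\<And>k. k \<in> Poly_Mapping.keys (d s) \<Longrightarrow> height w k < height w k0 \<or> height w k = height w k0 \<and> (0::int) \<le> 0"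
      using finite_lex_max[of "Poly_Mapping.keys (d s)" "height w" "\<lambda>_. 0"] d(1)[OF s] by auto
    have hk0: "- B \<le> height w k0" using B[OF s k0(1)] by linarith
    then have "k0 \<notin> Poly_Mapping.keys E" using E[of k0] by linarith
    with k0(1) have k0': "k0 \<in> Poly_Mapping.keys (f * q)"
      unfolding fq by (simp add: in_keys_iff lookup_add)
    then have q0: "q \<noteq> 0" by auto
    have "\<exists>x\<in>Poly_Mapping.keys (f * q). \<exists>y\<in>Poly_Mapping.keys (f * q). x \<noteq> y \<and>
       height w y = height w x \<and> (\<forall>k\<in>Poly_Mapping.keys (f * q). height w k \<le> height w x)"
      by (rule two_top_keys_mult[OF w e top q0])
    then obtain x y where
      xy: "x \<in> Poly_Mapping.keys (f * q)" "y \<in> Poly_Mapping.keys (f * q)" "x \<noteq> y" "height w y = height w x"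
      and xtop: "\<And>k. k \<in> Poly_Mapping.keys (f * q) \<Longrightarrow> height w k \<le> height w x"
      by blast
    have "height w k0 \<le> height w x" by (rule xtop[OF k0'])
    then have "x \<in> Poly_Mapping.keys (d s)" "y \<in> Poly_Mapping.keys (d s)"
      using in_d[OF xy(1)] in_d[OF xy(2)] hk0 xy(4) by linarith+
    then obtain i j where "x = zscale i a" "y = zscale j a" using d(3)[OF s] by meson
    with xy(3,4) ha show False by auto
  qed
qed

section \<open>Counting directions that are nearly attained twice\<close>

lemma height_swap: "height v w = - height w v"
  by (simp add: height_def)

lemma idot_diff: "idot w (x - y) = idot w x - idot w y"
  by (simp add: idot_def algebra_simps)

lemma idot_sq_pos: "w \<noteq> 0 \<Longrightarrow> 1 \<le> idot w w"
  by (cases w) (auto simp: idot_def zero_prod_def add_pos_nonneg add_nonneg_pos zero_less_mult_iff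
      int_one_le_iff_zero_less sum_squares_gt_zero_iff)

lemma idot_height_lagrange: "(idot w x)\<^sup>2 + (height w x)\<^sup>2 = idot w w * idot x x"
  by (simp add: idot_def height_def algebra_simps power2_eq_square)

lemma height_decompose: "idot w w * height v x = idot w x * height v w + height w x * idot v w"
  by (simp add: idot_def height_def algebra_simps)

lemma abs_idot_le:
  assumes "idot v v \<le> B" "idot w w \<le> B"
  shows "\<bar>idot v w\<bar> \<le> B"
proof -
  have nn: "0 \<le> idot v v" "0 \<le> idot w w" by (simp_all add: idot_def)
  then have "0 \<le> B" using assms by linarith
  have "(idot v w)\<^sup>2 \<le> idot v v * idot w w"
    using idot_height_lagrange[of v w] by (metis le_add_same_cancel1 zero_le_power2)
  also have "\<dots> \<le> B * B" using assms nn \<open>0 \<le> B\<close> by (intro mult_mono)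
  finally show ?thesis using \<open>0 \<le> B\<close> by (metis abs_le_square_iff abs_of_nonneg power2_eq_square)
qed

text \<open>A long vector \<open>x\<close> that is almost parallel to \<open>w\<close> and points forward is close to a large multiple of \<open>w\<close>. So if \<open>x\<close> hardly gains height in the
direction of \<open>v\<close>, then \<open>w\<close> cannot gain any.\<close>

lemma long_step_height:
  assumes B: "idot w w \<le> B" "idot v v \<le> B" and "0 \<le> C" and w: "w \<noteq> 0"
    and x: "\<bar>height w x\<bar> \<le> C" "0 \<le> idot w x" "(2 * C * B)\<^sup>2 + C\<^sup>2 < idot x x" "height v x \<le> C"
  shows "height v w \<le> 0"
proof (rule ccontr)
  assume "\<not> height v w \<le> 0"
  then have h: "1 \<le> height v w" by simp
  have w1: "1 \<le> idot w w" by (rule idot_sq_pos[OF w])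
  have "0 \<le> B" using B w1 by linarith
  have "\<bar>height w x * idot v w\<bar> \<le> C * B"
    unfolding abs_mult using x(1) abs_idot_le[OF B(2,1)] by (intro mult_mono) (use \<open>0 \<le> C\<close> in auto)
  moreover have "idot w w * height v x \<le> B * C"
  proof -
    have "idot w w * height v x \<le> idot w w * C" using x(4) w1 by (intro mult_left_mono) auto
    also have "\<dots> \<le> B * C" using B \<open>0 \<le> C\<close> by (intro mult_right_mono) auto
    finally show ?thesis .
  qed
  moreover have "idot w x \<le> idot w x * height v w"
    using mult_left_mono[OF h x(2)] by simp
  ultimately have "idot w x \<le> 2 * C * B"
    using height_decompose[of w v x] by (simp add: mult.commute[of B C])
  then have "(idot w x)\<^sup>2 \<le> (2 * C * B)\<^sup>2" using x(2) by (intro power_mono)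
  moreover have "(height w x)\<^sup>2 \<le> C\<^sup>2" using x(1) \<open>0 \<le> C\<close> abs_le_square_iff[of "height w x" C] by simp
  moreover have "idot x x \<le> idot w w * idot x x"
    using mult_right_mono[OF w1, of "idot x x"] by (simp add: idot_def)
  ultimately show False using idot_height_lagrange[of w x] x(3) by linarith
qed

text \<open>The heights in two independent directions are coordinates of the plane, so bounding both bounds the vector; the
constant comes from Cramer's rule.\<close>

lemma bounded_heights_bounded_norm:
  assumes B: "idot v v \<le> B" "idot w w \<le> B" and vw: "height v w \<noteq> 0"
    and x: "\<bar>height v x\<bar> \<le> C" "\<bar>height w x\<bar> \<le> C'"
  shows "idot x x \<le> B * (C + C')\<^sup>2"
proof -
  have id: "(height v w)\<^sup>2 * idot x x
      = (height w x)\<^sup>2 * idot v v + (height v x)\<^sup>2 * idot w w - 2 * (height w x * height v x * idot v w)"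
    by (simp add: idot_def height_def algebra_simps power2_eq_square)
  have nn: "0 \<le> C" "0 \<le> C'" using x by linarith+
  have b: "0 \<le> idot v v" "0 \<le> idot w w" by (simp_all add: idot_def)
  then have b0: "0 \<le> B" using B by linarith
  have "1 \<le> (height v w)\<^sup>2" using vw by (simp add: int_one_le_iff_zero_less)
  then have "idot x x \<le> (height v w)\<^sup>2 * idot x x"
    using mult_right_mono[of 1 "(height v w)\<^sup>2" "idot x x"] by (simp add: idot_def)
  also have "\<dots> \<le> C'\<^sup>2 * B + C\<^sup>2 * B + 2 * (C' * C * B)"
  proof -
    have "(height w x)\<^sup>2 * idot v v \<le> C'\<^sup>2 * B"
      using x(2) nn b b0 B abs_le_square_iff[of "height w x" C'] by (intro mult_mono) auto
    moreover have "(height v x)\<^sup>2 * idot w w \<le> C\<^sup>2 * B"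
      using x(1) nn b b0 B abs_le_square_iff[of "height v x" C] by (intro mult_mono) auto
    moreover have "\<bar>height w x * height v x * idot v w\<bar> \<le> C' * C * B"
      unfolding abs_mult using x nn b0 abs_idot_le[OF B] by (intro mult_mono) auto
    ultimately show ?thesis unfolding id by linarith
  qed
  also have "\<dots> = B * (C + C')\<^sup>2" by (simp add: power2_eq_square algebra_simps)
  finally show ?thesis .
qed

text \<open>Approximate version of the fact that a convex polygon with edges in \<open>R\<close> different directions has \<open>R\<close> vertices. Orient
the pair \<open>s, t\<close> of indices belonging to a direction so that \<open>n t - n s\<close> points forward, and map the direction to \<open>s\<close>.
If two directions had the same \<open>s\<close>, then by \<open>long_step_height\<close> neither could gain height along the other, so they would be opposite.
All points would then lie in a strip of bounded width along these directions, and a third direction would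
force two points to be close to each other.\<close>

lemma card_le_of_nearly_attained_directions:
  fixes n :: "'i \<Rightarrow> int \<times> int" and w :: "'v \<Rightarrow> int \<times> int"
  assumes T: "finite T" and V: "3 \<le> card V" and C: "0 \<le> C"
    and w0: "\<And>e. e \<in> V \<Longrightarrow> w e \<noteq> 0" and B: "\<And>e. e \<in> V \<Longrightarrow> idot (w e) (w e) \<le> B"
    and distinct_dirs: "\<And>e e'. e \<in> V \<Longrightarrow> e' \<in> V \<Longrightarrow> e \<noteq> e' \<Longrightarrow> height (w e) (w e') = 0 \<Longrightarrow> idot (w e) (w e') \<le> 0"
    and far: "\<And>s t. s \<in> T \<Longrightarrow> t \<in> T \<Longrightarrow> s \<noteq> t \<Longrightarrow>
       (2 * C * B)\<^sup>2 + C\<^sup>2 + B * (2 * C + B * C)\<^sup>2 < idot (n s - n t) (n s - n t)"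
    and near: "\<And>e. e \<in> V \<Longrightarrow> \<exists>s\<in>T. \<exists>t\<in>T. s \<noteq> t \<and>
       (\<forall>x\<in>T. height (w e) (n x) \<le> height (w e) (n s) + C \<and> height (w e) (n x) \<le> height (w e) (n t) + C)"
  shows "card V \<le> card T"
proof -
  define Q where "Q = (\<lambda>e s t. s \<in> T \<and> t \<in> T \<and> s \<noteq> t \<and> 0 \<le> idot (w e) (n t - n s) \<and>
     (\<forall>x\<in>T. height (w e) (n x) \<le> height (w e) (n s) + C \<and> height (w e) (n x) \<le> height (w e) (n t) + C))"
  have "\<exists>s t. Q e s t" if "e \<in> V" for e
  proof -
    from near[OF that] obtain s t where st: "s \<in> T" "t \<in> T" "s \<noteq> t"
      "\<forall>x\<in>T. height (w e) (n x) \<le> height (w e) (n s) + C \<and> height (w e) (n x) \<le> height (w e) (n t) + C"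
      by blast
    show ?thesis
    proof (cases "0 \<le> idot (w e) (n t - n s)")
      case True
      with st show ?thesis unfolding Q_def by blast
    next
      case False
      then have "0 \<le> idot (w e) (n s - n t)" by (simp add: idot_diff)
      with st show ?thesis unfolding Q_def by (intro exI[of _ t] exI[of _ s]) auto
    qed
  qed
  then obtain s t where Q: "\<And>e. e \<in> V \<Longrightarrow> Q e (s e) (t e)" by metis
  then have st: "\<And>e. e \<in> V \<Longrightarrow> s e \<in> T" "\<And>e. e \<in> V \<Longrightarrow> t e \<in> T" "\<And>e. e \<in> V \<Longrightarrow> s e \<noteq> t e"
      "\<And>e. e \<in> V \<Longrightarrow> 0 \<le> idot (w e) (n (t e) - n (s e))"
    and s_top: "\<And>e x. e \<in> V \<Longrightarrow> x \<in> T \<Longrightarrow> height (w e) (n x) \<le> height (w e) (n (s e)) + C"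
    and t_top: "\<And>e x. e \<in> V \<Longrightarrow> x \<in> T \<Longrightarrow> height (w e) (n x) \<le> height (w e) (n (t e)) + C"
    unfolding Q_def by blast+
  let ?\<delta> = "\<lambda>e. n (t e) - n (s e)"
  have step: "\<bar>height (w e) (?\<delta> e)\<bar> \<le> C" if "e \<in> V" for e
    using s_top[OF that st(2)[OF that]] t_top[OF that st(1)[OF that]] by (simp add: abs_le_iff)
  have B0: "0 \<le> B" if "e \<in> V" for e
    using B[OF that] idot_sq_pos[OF w0[OF that]] by linarith
  have far1: "(2 * C * B)\<^sup>2 + C\<^sup>2 < idot (?\<delta> e) (?\<delta> e)" and far2: "B * (2 * C + B * C)\<^sup>2 < idot (?\<delta> e) (?\<delta> e)"
    if "e \<in> V" for e
  proof -
    have "0 \<le> B * (2 * C + B * C)\<^sup>2" "0 \<le> (2 * C * B)\<^sup>2 + C\<^sup>2" using B0[OF that] by simp_all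
    then show "(2 * C * B)\<^sup>2 + C\<^sup>2 < idot (?\<delta> e) (?\<delta> e)" "B * (2 * C + B * C)\<^sup>2 < idot (?\<delta> e) (?\<delta> e)"
      using far[OF st(2,1)[OF that] st(3)[OF that, symmetric]] by linarith+
  qed
  have "inj_on s V"
  proof (rule inj_onI, rule ccontr)
    fix e1 e2 assume e: "e1 \<in> V" "e2 \<in> V" and s: "s e1 = s e2" and ne: "e1 \<noteq> e2"
    have par: "height (w e) (w e') \<le> 0" if "e \<in> V" "e' \<in> V" "s e = s e'" for e e'
    proof (rule long_step_height[OF B[OF that(2)] B[OF that(1)] C w0[OF that(2)] step[OF that(2)] st(4)[OF that(2)] far1[OF that(2)]])
      show "height (w e) (?\<delta> e') \<le> C"
        using s_top[OF that(1) st(2)[OF that(2)]] that(3) by simp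
    qed
    have h12: "height (w e1) (w e2) = 0"
      using par[OF e s] par[OF e(2,1) s[symmetric]] height_swap[of "w e1" "w e2"] by linarith
    have "idot (w e1) (w e2) \<noteq> 0"
      using idot_height_lagrange[of "w e1" "w e2"] h12 idot_sq_pos[OF w0[OF e(1)]] idot_sq_pos[OF w0[OF e(2)]]
      by auto
    then have neg: "idot (w e1) (w e2) \<le> -1" using distinct_dirs[OF e ne h12] by linarith
    \<comment> \<open>The two heights have opposite signs, so bounding both from above confines all points to a strip.\<close>
    have strip: "- (B * C) \<le> height (w e1) (n x - n (s e1)) \<and> height (w e1) (n x - n (s e1)) \<le> C" if "x \<in> T" for x
    proof
      let ?D = "n x - n (s e1)" and ?i = "idot (w e1) (w e2)"
      show "height (w e1) ?D \<le> C" using s_top[OF e(1) that] by simp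
      have h2: "height (w e2) ?D \<le> C" using s_top[OF e(2) that] s by simp
      have "idot (w e1) (w e1) * height (w e2) ?D = height (w e1) ?D * ?i"
        using height_decompose[of "w e1" "w e2" ?D] h12 height_swap[of "w e1" "w e2"]
        by (simp add: idot_def mult.commute)
      moreover have "idot (w e1) (w e1) * height (w e2) ?D \<le> B * C"
      proof -
        have "idot (w e1) (w e1) * height (w e2) ?D \<le> idot (w e1) (w e1) * C"
          using h2 idot_sq_pos[OF w0[OF e(1)]] by (intro mult_left_mono) auto
        also have "\<dots> \<le> B * C" using B[OF e(1)] C by (intro mult_right_mono)
        finally show ?thesis .
      qed
      ultimately have le: "height (w e1) ?D * ?i \<le> B * C" by simp
      show "- (B * C) \<le> height (w e1) ?D"
      proof (cases "0 \<le> height (w e1) ?D")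
        case True
        moreover have "0 \<le> B * C" using B0[OF e(1)] C by simp
        ultimately show ?thesis by linarith
      next
        case False
        then have "height (w e1) ?D * (-1) \<le> height (w e1) ?D * ?i"
          using neg by (intro mult_left_mono_neg) auto
        with le show ?thesis by linarith
      qed
    qed
    obtain e3 where e3: "e3 \<in> V" "e3 \<noteq> e1" "e3 \<noteq> e2"
    proof -
      have "finite V" using V card.infinite by fastforce
      then have "V - {e1, e2} \<noteq> {}"
        using V card_mono[of "{e1, e2}" V] ne by (auto simp: card_insert_if)
      then show thesis using that by auto
    qed
    have h13: "height (w e1) (w e3) \<noteq> 0"
    proof
      assume h13: "height (w e1) (w e3) = 0"
      have le13: "idot (w e1) (w e3) \<le> 0" using distinct_dirs[OF e(1) e3(1) e3(2)[symmetric] h13] .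
      have "idot (w e1) (w e1) * height (w e2) (w e3) = 0"
        using height_decompose[of "w e1" "w e2" "w e3"] h13 h12 height_swap[of "w e1" "w e2"] by simp
      then have h23: "height (w e2) (w e3) = 0" using idot_sq_pos[OF w0[OF e(1)]] by auto
      have le23: "idot (w e2) (w e3) \<le> 0" using distinct_dirs[OF e(2) e3(1) e3(3)[symmetric] h23] .
      have "idot (w e1) (w e3) \<noteq> 0"
        using idot_height_lagrange[of "w e1" "w e3"] h13 idot_sq_pos[OF w0[OF e(1)]] idot_sq_pos[OF w0[OF e3(1)]]
        by auto
      then have "0 < idot (w e1) (w e2) * idot (w e1) (w e3)"
        using le13 neg by (intro mult_neg_neg) auto
      also have "\<dots> = idot (w e1) (w e1) * idot (w e2) (w e3) - height (w e1) (w e2) * height (w e1) (w e3)"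
        by (simp add: idot_def height_def algebra_simps)
      also have "\<dots> \<le> 0"
        unfolding h12 using le23 idot_sq_pos[OF w0[OF e(1)]] by (simp add: mult_nonneg_nonpos)
      finally show False by simp
    qed
    have "\<bar>height (w e1) (?\<delta> e3)\<bar> \<le> C + B * C"
      using strip[OF st(1)[OF e3(1)]] strip[OF st(2)[OF e3(1)]] by (auto simp: abs_le_iff)
    then have "idot (?\<delta> e3) (?\<delta> e3) \<le> B * ((C + B * C) + C)\<^sup>2"
      using bounded_heights_bounded_norm[OF B[OF e(1)] B[OF e3(1)] h13 _ step[OF e3(1)]] by blast
    moreover have "(C + B * C) + C = 2 * C + B * C" by simp
    ultimately show False using far2[OF e3(1)] by simp
  qed
  moreover have "s ` V \<subseteq> T" using st(1) by blast
  ultimately show ?thesis using T by (rule card_inj_on_le)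
qed

section \<open>Edges of the Newton polygon\<close>

definition real_point :: "int \<times> int \<Rightarrow> real \<times> real" where
  "real_point = (\<lambda>(a, b). (real_of_int a, real_of_int b))"

lemma inj_real_point: "inj real_point"
  by (auto simp: inj_def real_point_def)

lemma real_point_diff: "real_point (x - y) = real_point x - real_point y"
  by (cases x; cases y) (simp add: real_point_def)

text \<open>Vertices are encoded by strict support: some linear functional, with real coefficients, attains its minimum over \<open>S\<close> only there. This is
the only property of extreme points that the sequel needs.\<close>

definition vertices :: "(int \<times> int) set \<Rightarrow> (int \<times> int) set" where
  "vertices S = {e \<in> S. \<exists>l. \<forall>x\<in>S. x \<noteq> e \<longrightarrow> 0 < l \<bullet> real_point (x - e)}"

lemma extreme_points_subset_vertices:
  assumes "finite S"
  shows "{v. v extreme_point_of (convex hull (real_point ` S))} \<subseteq> real_point ` vertices S"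
proof
  fix v assume "v \<in> {v. v extreme_point_of (convex hull (real_point ` S))}"
  then have v: "v extreme_point_of (convex hull (real_point ` S))" by simp
  then have "v \<in> real_point ` S" by (rule extreme_point_of_convex_hull)
  then obtain e where e: "e \<in> S" "v = real_point e" by auto
  let ?H = "convex hull (real_point ` (S - {e}))"
  have "convex (convex hull (real_point ` S) - {v})"
    using v extreme_point_of_stillconvex by auto
  moreover have "real_point ` (S - {e}) \<subseteq> convex hull (real_point ` S) - {v}"
    using hull_subset[of "real_point ` S" convex] inj_real_point by (auto simp: e inj_eq)
  ultimately have "?H \<subseteq> convex hull (real_point ` S) - {v}" by (intro hull_minimal)
  then have "real_point e \<notin> ?H" using e by auto
  moreover have "closed ?H" using assms by (intro compact_imp_closed compact_convex_hull finite_imp_compact) auto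
  ultimately obtain l b where lb: "l \<bullet> real_point e < b" "\<forall>x\<in>?H. b < l \<bullet> x"
    using separating_hyperplane_closed_point[of ?H "real_point e"] by auto
  have "0 < l \<bullet> real_point (x - e)" if "x \<in> S" "x \<noteq> e" for x
  proof -
    have "real_point x \<in> ?H" using that by (auto intro: hull_inc)
    with lb have "b < l \<bullet> real_point x" by blast
    with lb(1) show ?thesis by (simp add: real_point_diff inner_diff_right)
  qed
  with e show "v \<in> real_point ` vertices S" unfolding vertices_def by blast
qed

text \<open>Gift wrapping: seen from a vertex, all other points lie in an open half-plane, so there is a rightmost ray through one of
them. The slope with respect to the supporting functional is minimised to find it.\<close>

lemma vertex_next:
  assumes S: "finite S" and e: "e \<in> vertices S" and ne: "S \<noteq> {e}"
  shows "\<exists>e'\<in>S. e' \<noteq> e \<and> (\<forall>x\<in>S. height (e' - e) x \<le> height (e' - e) e)"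
proof -
  obtain l1 l2 where l: "\<And>x. x \<in> S \<Longrightarrow> x \<noteq> e \<Longrightarrow> 0 < (l1, l2) \<bullet> real_point (x - e)"
    using e unfolding vertices_def by auto
  let ?L = "\<lambda>d. l1 * fst (real_point d) + l2 * snd (real_point d)"
  let ?c = "\<lambda>d. l1 * snd (real_point d) - l2 * fst (real_point d)"
  have L: "0 < ?L (x - e)" if "x \<in> S" "x \<noteq> e" for x
    using l[OF that] by (simp add: inner_prod_def)
  have "finite (S - {e})" "S - {e} \<noteq> {}" using S e ne by (auto simp: vertices_def)
  then obtain e' where e': "e' \<in> S" "e' \<noteq> e"
    and least: "\<And>x. x \<in> S \<Longrightarrow> x \<noteq> e \<Longrightarrow> ?c (e' - e) / ?L (e' - e) \<le> ?c (x - e) / ?L (x - e)"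
    using arg_min_if_finite[of "S - {e}" "\<lambda>x. ?c (x - e) / ?L (x - e)"]
    by (metis (no_types, lifting) Diff_iff insertCI not_less singletonD)
  have "height (e' - e) (x - e) \<le> 0" if x: "x \<in> S" for x
  proof (cases "x = e")
    case False
    let ?d = "e' - e" and ?d' = "x - e"
    have "?c ?d * ?L ?d' \<le> ?c ?d' * ?L ?d"
      using least[OF x False] L[OF x False] L[OF e'] by (simp add: divide_simps mult.commute)
    moreover have "(l1\<^sup>2 + l2\<^sup>2) * real_of_int (height ?d ?d') = ?c ?d * ?L ?d' - ?c ?d' * ?L ?d"
      by (simp add: height_def real_point_def split_beta algebra_simps power2_eq_square)
    ultimately have "(l1\<^sup>2 + l2\<^sup>2) * real_of_int (height ?d ?d') \<le> 0" by linarith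
    moreover have "0 < l1\<^sup>2 + l2\<^sup>2" using L[OF e'] by (auto simp: sum_power2_gt_zero_iff)
    ultimately show ?thesis by (simp add: mult_le_0_iff)
  qed (simp add: height_def)
  then show ?thesis using e' by (intro bexI[of _ e']) (auto simp: height_diff)
qed

lemma parallel_inner:
  assumes "height v x = 0"
  shows "real_of_int (idot v v) * (l \<bullet> real_point x) = real_of_int (idot v x) * (l \<bullet> real_point v)"
proof -
  obtain v1 v2 where v: "v = (v1, v2)" by (cases v)
  obtain x1 x2 where x: "x = (x1, x2)" by (cases x)
  obtain l1 l2 where l: "l = (l1, l2)" by (cases l)
  have "x1 * v2 = x2 * v1" using assms by (simp add: height_def v x)
  then have r: "real_of_int x1 * v2 = real_of_int x2 * v1" by (metis of_int_mult)
  have "real_of_int (idot v v) * (l \<bullet> real_point x) - real_of_int (idot v x) * (l \<bullet> real_point v)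
     = (l1 * v2 - l2 * v1) * (real_of_int x1 * v2 - real_of_int x2 * v1)"
    by (simp add: v x l idot_def real_point_def inner_prod_def algebra_simps)
  with r show ?thesis by simp
qed

text \<open>Two edges with the same direction and the same outward normal lie on one line, so of their starting points, one lies
strictly between two other points of \<open>S\<close> on that line. This is impossible for a vertex.\<close>

lemma edge_directions_distinct:
  assumes v1: "e1 \<in> vertices S" and v2: "e2 \<in> vertices S" and ne: "e1 \<noteq> e2"
    and n1: "n1 \<in> S" "n1 \<noteq> e1" "\<And>x. x \<in> S \<Longrightarrow> height (n1 - e1) x \<le> height (n1 - e1) e1"
    and n2: "n2 \<in> S" "n2 \<noteq> e2" "\<And>x. x \<in> S \<Longrightarrow> height (n2 - e2) x \<le> height (n2 - e2) e2"
    and par: "height (n1 - e1) (n2 - e2) = 0"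
  shows "idot (n1 - e1) (n2 - e2) \<le> 0"
proof (rule ccontr)
  assume neg: "\<not> idot (n1 - e1) (n2 - e2) \<le> 0"
  let ?w1 = "n1 - e1" and ?w2 = "n2 - e2" and ?D = "e2 - e1"
  have S: "e1 \<in> S" "e2 \<in> S" using v1 v2 by (auto simp: vertices_def)
  have w1: "1 \<le> idot ?w1 ?w1" using n1(2) by (intro idot_sq_pos) simp
  have a: "height ?w1 ?D \<le> 0" using n1(3)[OF S(2)] by simp
  have b: "0 \<le> height ?w2 ?D" using n2(3)[OF S(1)] by simp
  have "idot ?w1 ?w1 * height ?w2 ?D = idot ?w1 ?D * height ?w2 ?w1 + height ?w1 ?D * idot ?w2 ?w1"
    by (rule height_decompose)
  also have "height ?w2 ?w1 = 0" using par height_swap[of ?w2 ?w1] by simp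
  finally have "0 \<le> height ?w1 ?D * idot ?w2 ?w1" using b w1 by (metis mult_zero_right add_0 mult_nonneg_nonneg order_trans zero_le_one)
  moreover have "idot ?w2 ?w1 = idot ?w1 ?w2" by (simp add: idot_def mult.commute)
  ultimately have hD: "height ?w1 ?D = 0" using a neg by (metis le_less mult_neg_pos not_le)
  have D0: "idot ?w1 ?D \<noteq> 0"
    using height_idot_inj[of ?w1 ?D 0] hD n1(2) ne by (auto simp: idot_def height_def)
  obtain l where l: "\<And>x. x \<in> S \<Longrightarrow> x \<noteq> e1 \<Longrightarrow> 0 < l \<bullet> real_point (x - e1)"
    using v1 by (auto simp: vertices_def)
  obtain l' where l': "\<And>x. x \<in> S \<Longrightarrow> x \<noteq> e2 \<Longrightarrow> 0 < l' \<bullet> real_point (x - e2)"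
    using v2 by (auto simp: vertices_def)
  have w1r: "0 < real_of_int (idot ?w1 ?w1)" using w1 by simp
  show False
  proof (cases "0 < idot ?w1 ?D")
    case True
    have "0 < real_of_int (idot ?w1 ?w1) * (l' \<bullet> real_point ?w2)" using l'[OF n2(1,2)] w1r by simp
    then have "0 < real_of_int (idot ?w1 ?w2) * (l' \<bullet> real_point ?w1)" by (simp add: parallel_inner[OF par])
    then have "0 < l' \<bullet> real_point ?w1" using neg by (simp add: zero_less_mult_iff)
    with True have "0 < real_of_int (idot ?w1 ?D) * (l' \<bullet> real_point ?w1)" by simp
    then have "0 < real_of_int (idot ?w1 ?w1) * (l' \<bullet> real_point ?D)" by (simp add: parallel_inner[OF hD])
    with w1r have "0 < l' \<bullet> real_point ?D" by (simp add: zero_less_mult_iff)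
    with l'[OF S(1) ne] show False by (simp add: real_point_diff inner_diff_right)
  next
    case False
    with D0 have "idot ?w1 ?D < 0" by simp
    moreover have "0 < l \<bullet> real_point ?w1" using l[OF n1(1,2)] .
    ultimately have "real_of_int (idot ?w1 ?D) * (l \<bullet> real_point ?w1) < 0" by (simp add: mult_neg_pos)
    then have "real_of_int (idot ?w1 ?w1) * (l \<bullet> real_point ?D) < 0" by (simp add: parallel_inner[OF hD])
    with w1r have "l \<bullet> real_point ?D < 0" by (simp add: mult_less_0_iff)
    with l[OF S(2) ne[symmetric]] show False by simp
  qed
qed

lemma eventually_norm_gt:
  assumes "filterlim n cofinite F"
  shows "eventually (\<lambda>j. K < idot (n j) (n j)) F"
proof -
  have "{x. \<not> K < idot x x} \<subseteq> {- \<bar>K\<bar>..\<bar>K\<bar>} \<times> {- \<bar>K\<bar>..\<bar>K\<bar>}"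
  proof
    fix x :: "int \<times> int" assume "x \<in> {x. \<not> K < idot x x}"
    then have le: "fst x * fst x + snd x * snd x \<le> K" by (simp add: idot_def)
    have "\<bar>y\<bar> \<le> y * y" for y :: int
      by (cases "y = 0") (use mult_left_mono[of 1 "\<bar>y\<bar>" "\<bar>y\<bar>"] in auto)
    with le have "\<bar>fst x\<bar> \<le> \<bar>K\<bar>" "\<bar>snd x\<bar> \<le> \<bar>K\<bar>"
      using zero_le_square[of "fst x"] zero_le_square[of "snd x"] by (smt (verit))+
    then show "x \<in> {- \<bar>K\<bar>..\<bar>K\<bar>} \<times> {- \<bar>K\<bar>..\<bar>K\<bar>}" by (cases x) (auto simp: abs_le_iff)
  qed
  then have "finite {x. \<not> K < idot x x}" by (rule finite_subset) simp
  then have "eventually (\<lambda>x. K < idot x x) cofinite" by (simp add: eventually_cofinite)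
  then show ?thesis using assms unfolding filterlim_iff by blast
qed

text \<open>With a single translate there is nothing to cancel against. Otherwise \<open>R \<ge> 3\<close>, and if the sum is divisible by \<open>f\<close> while
the exponents are far apart, then the \<open>R\<close> edge directions are nearly attained twice each, and the counting lemma gives \<open>R \<le> card T\<close>.\<close>

theorem eventually_no_relation:
  fixes f :: "'p::prime_card laurent" and m :: "'i \<Rightarrow> 'p laurent" and n :: "nat \<Rightarrow> 'i \<Rightarrow> int \<times> int"
  assumes f: "Factorial_Ring.irreducible f" and R: "is_gon R (newton_polygon f)"
    and T: "finite T" "T \<noteq> {}" "card T < R" and m: "\<And>t. t \<in> T \<Longrightarrow> \<not> f dvd m t"
    and n: "\<And>s t. s \<in> T \<Longrightarrow> t \<in> T \<Longrightarrow> s \<noteq> t \<Longrightarrow> filterlim (\<lambda>j. n j s - n j t) cofinite sequentially"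
  shows "eventually (\<lambda>j. \<not> f dvd (\<Sum>t\<in>T. Poly_Mapping.single (n j t) 1 * m t)) sequentially"
proof (cases "card T = 1")
  case True
  then obtain t where t: "T = {t}" by (rule card_1_singletonE)
  have "\<not> f dvd Poly_Mapping.single k 1 * m t" for k
  proof
    assume "f dvd Poly_Mapping.single k 1 * m t"
    then have "f dvd Poly_Mapping.single (- k) 1 * (Poly_Mapping.single k 1 * m t)" by (rule dvd_mult)
    then show False using m t by (simp add: mult_single mult.assoc[symmetric])
  qed
  then show ?thesis by (simp add: t)
next
  case False
  moreover have "card T \<noteq> 0" using T by simp
  ultimately have R3: "3 \<le> R" using T(3) by linarith
  let ?S = "Poly_Mapping.keys f"
  define V where "V = vertices ?S"
  have V_S: "V \<subseteq> ?S" by (auto simp: V_def vertices_def)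
  have fV: "finite V" by (rule finite_subset[OF V_S finite_keys])
  have "R = card {v. v extreme_point_of (convex hull (real_point ` ?S))}"
    using R by (simp add: is_gon_def newton_polygon_def real_point_def)
  also have "\<dots> \<le> card (real_point ` V)"
    using extreme_points_subset_vertices[OF finite_keys, of f] fV
    unfolding V_def[symmetric] by (intro card_mono finite_imageI)
  also have "\<dots> \<le> card V" using fV by (rule card_image_le)
  finally have RV: "R \<le> card V" .
  have "?S \<noteq> {e}" for e
    using RV R3 card_mono[OF finite_keys V_S] by auto
  then have "\<forall>e\<in>V. \<exists>e'. e' \<in> ?S \<and> e' \<noteq> e \<and> (\<forall>x\<in>?S. height (e' - e) x \<le> height (e' - e) e)"
    using vertex_next[OF finite_keys, of _ f] unfolding V_def by blast
  then obtain nx where nx: "\<And>e. e \<in> V \<Longrightarrow> nx e \<in> ?S" "\<And>e. e \<in> V \<Longrightarrow> nx e \<noteq> e"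
    "\<And>e x. e \<in> V \<Longrightarrow> x \<in> ?S \<Longrightarrow> height (nx e - e) x \<le> height (nx e - e) e"
    by metis
  let ?w = "\<lambda>e. nx e - e"
  let ?rel = "\<lambda>n. f dvd (\<Sum>t\<in>T. Poly_Mapping.single (n t) 1 * m t)"
  have w0: "?w e \<noteq> 0" if "e \<in> V" for e using nx(2)[OF that] by simp
  have "\<exists>C. \<forall>n. ?rel n \<longrightarrow> (\<forall>s\<in>T. \<exists>t\<in>T - {s}. height (?w e) (n s) \<le> height (?w e) (n t) + C)"
    if e: "e \<in> V" for e
  proof (rule vanishing_sum_top_twice[OF f w0[OF e] _ nx(1)[OF e] nx(2)[OF e, symmetric] _ nx(3)[OF e] T(1) m])
    show "e \<in> ?S" using e V_S by blast
    show "height (?w e) (nx e) = height (?w e) e" by (simp add: height_def algebra_simps)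
  qed
  then have "\<forall>e\<in>V. \<exists>C. \<forall>n. ?rel n \<longrightarrow> (\<forall>s\<in>T. \<exists>t\<in>T - {s}. height (?w e) (n s) \<le> height (?w e) (n t) + C)"
    by (rule ballI)
  then have "\<exists>C. \<forall>e\<in>V. \<forall>n. ?rel n \<longrightarrow>
      (\<forall>s\<in>T. \<exists>t\<in>T - {s}. height (?w e) (n s) \<le> height (?w e) (n t) + C e)"
    by (rule bchoice)
  then obtain C where C: "\<forall>e\<in>V. \<forall>n. ?rel n \<longrightarrow>
      (\<forall>s\<in>T. \<exists>t\<in>T - {s}. height (?w e) (n s) \<le> height (?w e) (n t) + C e)" by (rule exE)
  obtain C0 where C0: "0 \<le> C0 \<and> (\<forall>e\<in>V. \<bar>C e\<bar> \<le> C0)"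
    using bounded_on_finite[OF fV, of C] by (rule exE)
  obtain B where B: "0 \<le> B \<and> (\<forall>e\<in>V. \<bar>idot (?w e) (?w e)\<bar> \<le> B)"
    using bounded_on_finite[OF fV, of "\<lambda>e. idot (?w e) (?w e)"] by (rule exE)
  define E where "E = (2 * C0 * B)\<^sup>2 + C0\<^sup>2 + B * (2 * C0 + B * C0)\<^sup>2"
  have "eventually (\<lambda>j. \<forall>s\<in>T. \<forall>t\<in>T. s \<noteq> t \<longrightarrow> E < idot (n j s - n j t) (n j s - n j t)) sequentially"
  proof (intro eventually_ball_finite[OF T(1)] ballI)
    fix s t assume st: "s \<in> T" "t \<in> T"
    show "eventually (\<lambda>j. s \<noteq> t \<longrightarrow> E < idot (n j s - n j t) (n j s - n j t)) sequentially"
      by (cases "s = t") (use eventually_norm_gt[OF n[OF st], of E] in auto)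
  qed
  then show ?thesis
  proof eventually_elim
    case (elim j)
    show ?case
    proof
      assume rel: "?rel (n j)"
      have V3: "3 \<le> card V" using R3 RV by (rule order_trans)
      have wB: "idot (?w e) (?w e) \<le> B" if "e \<in> V" for e using B that by fastforce
      have dist: "idot (?w e) (?w e') \<le> 0"
        if e: "e \<in> V" and e': "e' \<in> V" and "e \<noteq> e'" "height (?w e) (?w e') = 0" for e e'
        by (rule edge_directions_distinct[OF e[unfolded V_def] e'[unfolded V_def] that(3)
              nx(1)[OF e] nx(2)[OF e] nx(3)[OF e] nx(1)[OF e'] nx(2)[OF e'] nx(3)[OF e'] that(4)])
      have far: "(2 * C0 * B)\<^sup>2 + C0\<^sup>2 + B * (2 * C0 + B * C0)\<^sup>2 < idot (n j s - n j t) (n j s - n j t)"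
        if "s \<in> T" "t \<in> T" "s \<noteq> t" for s t using elim that unfolding E_def by blast
      have near: "\<exists>s\<in>T. \<exists>t\<in>T. s \<noteq> t \<and> (\<forall>x\<in>T. height (?w e) (n j x) \<le> height (?w e) (n j s) + C0 \<and>
            height (?w e) (n j x) \<le> height (?w e) (n j t) + C0)" if e: "e \<in> V" for e
      proof -
        have "\<exists>s\<in>T. \<forall>x\<in>T. height (?w e) (n j x) \<le> height (?w e) (n j s)"
          using Max_in[of "(\<lambda>x. height (?w e) (n j x)) ` T"] Max_ge[of "(\<lambda>x. height (?w e) (n j x)) ` T"] T(1,2)
          by fastforce
        then obtain s where s: "s \<in> T" "\<And>x. x \<in> T \<Longrightarrow> height (?w e) (n j x) \<le> height (?w e) (n j s)"
          by blast
        have "\<exists>t\<in>T - {s}. height (?w e) (n j s) \<le> height (?w e) (n j t) + C e"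
          using C e rel s(1) by blast
        then obtain t where t: "t \<in> T" "t \<noteq> s" "height (?w e) (n j s) \<le> height (?w e) (n j t) + C e"
          by blast
        have C0le: "0 \<le> C0" "\<bar>C e\<bar> \<le> C0" using C0 e by auto
        have "height (?w e) (n j x) \<le> height (?w e) (n j s) + C0 \<and> height (?w e) (n j x) \<le> height (?w e) (n j t) + C0"
          if "x \<in> T" for x
          using s(2)[OF that] t(3) C0le by linarith
        with s(1) t(1,2) show ?thesis by blast
      qed
      have "card V \<le> card T"
        by (rule card_le_of_nearly_attained_directions[where w = ?w and n = "n j",
              OF T(1) V3 conjunct1[OF C0] w0 wB dist far near])
      with RV T(3) show False by simp
    qed
  qed
qed

section \<open>Characters of the quotient module\<close>

definition coset :: "'p::prime_card laurent \<Rightarrow> 'p laurent \<Rightarrow> 'p laurent set" where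
  "coset f g = PIdl\<^bsub>laurent_ring\<^esub> f +>\<^bsub>laurent_ring\<^esub> g"

lemma coset_eq: "coset f g = {h. f dvd h - g}"
  unfolding coset_def a_r_coset_def r_coset_def cgenideal_def ring_of_type_algebra_def
  by (auto simp: dvd_def algebra_simps intro: exI[of _ "_ - g"])

lemma coset_eq_iff: "coset f g = coset f h \<longleftrightarrow> f dvd g - h"
proof
  assume eq: "coset f g = coset f h"
  have "g \<in> coset f g" by (simp add: coset_eq)
  then have "g \<in> coset f h" unfolding eq .
  then show "f dvd g - h" by (simp add: coset_eq)
next
  assume *: "f dvd g - h"
  have "f dvd k - g \<longleftrightarrow> f dvd k - h" for k
  proof
    assume "f dvd k - g"
    from dvd_add[OF this *] show "f dvd k - h" by simp
  next
    assume "f dvd k - h"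
    from dvd_diff[OF this *] show "f dvd k - g" by simp
  qed
  then show "coset f g = coset f h" by (simp add: coset_eq)
qed

lemma ideal_PIdl: "ideal (PIdl\<^bsub>laurent_ring\<^esub> f) (laurent_ring :: 'p::prime_card laurent ring)"
  by (rule cring.cgenideal_ideal[OF cring_from_type_algebra]) (simp add: ring_of_type_algebra_def)

lemma carrier_quot_ring: "carrier (quot_ring f) = range (coset f)"
  by (auto simp: quot_ring_def FactRing_def A_RCOSETS_def' coset_def ring_of_type_algebra_def)

lemma quot_ring_add: "coset f g \<oplus>\<^bsub>quot_ring f\<^esub> coset f h = coset f (g + h)"
proof -
  have "coset f g <+>\<^bsub>laurent_ring\<^esub> coset f h = PIdl\<^bsub>laurent_ring\<^esub> f +>\<^bsub>laurent_ring\<^esub> (g \<oplus>\<^bsub>laurent_ring\<^esub> h)"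
    unfolding coset_def by (rule ideal.a_rcos_sum[OF ideal_PIdl]) (simp_all add: ring_of_type_algebra_def)
  then show ?thesis
    by (simp add: quot_ring_def FactRing_def coset_def ring_of_type_algebra_def)
qed

lemma monom_mult_coset: "monom_mult f n (coset f g) = coset f (Poly_Mapping.single n 1 * g)"
proof -
  have "rcoset_mult laurent_ring (PIdl\<^bsub>laurent_ring\<^esub> f) (coset f (laurent_monom n)) (coset f g)
     = PIdl\<^bsub>laurent_ring\<^esub> f +>\<^bsub>laurent_ring\<^esub> (laurent_monom n \<otimes>\<^bsub>laurent_ring\<^esub> g)"
    unfolding coset_def by (rule ideal.rcoset_mult_add[OF ideal_PIdl]) (simp_all add: ring_of_type_algebra_def)
  then show ?thesis
    by (simp add: monom_mult_def quot_ring_def FactRing_def coset_def ring_of_type_algebra_def laurent_monom_def)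
qed

definition chars :: "'p::prime_card laurent \<Rightarrow> ('p laurent set \<Rightarrow> complex) set" where
  "chars f = carrier (dual_group (quot_group f))"

lemma chars_iff:
  "x \<in> chars f \<longleftrightarrow> x \<in> extensional (range (coset f)) \<and> (\<forall>g. norm (x (coset f g)) = 1) \<and>
     (\<forall>g h. x (coset f (g + h)) = x (coset f g) * x (coset f h))"
  unfolding chars_def dual_group_def hom_def circle_group_def
  by (auto simp: carrier_quot_ring quot_ring_add Pi_iff)

lemma
  assumes "x \<in> chars f"
  shows norm_char: "norm (x (coset f g)) = 1"
    and char_add: "x (coset f (g + h)) = x (coset f g) * x (coset f h)"
  using assms by (auto simp: chars_iff)

lemma char_nonzero: "x \<in> chars f \<Longrightarrow> x (coset f g) \<noteq> 0"
  using norm_char[of x f g] by auto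

lemma char_zero: "x \<in> chars f \<Longrightarrow> x (coset f 0) = 1"
  using char_add[of x f 0 0] char_nonzero[of x f 0] by simp

lemma char_dvd: "x \<in> chars f \<Longrightarrow> f dvd g \<Longrightarrow> x (coset f g) = 1"
  using char_zero[of x f] coset_eq_iff[of f g 0] by simp

lemma char_of_nat: "x \<in> chars f \<Longrightarrow> x (coset f (of_nat k * g)) = x (coset f g) ^ k"
  by (induction k) (simp_all add: char_zero char_add distrib_right)

lemma char_sum: "x \<in> chars f \<Longrightarrow> x (coset f (\<Sum>i\<in>I. g i)) = (\<Prod>i\<in>I. x (coset f (g i)))"
  by (induction I rule: infinite_finite_induct) (simp_all add: char_zero char_add)

lemma of_nat_card_laurent: "of_nat CARD('p) = (0 :: 'p::prime_card laurent)"
proof -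
  have "(of_nat CARD('p) :: 'p laurent) = Poly_Mapping.single 0 (of_nat CARD('p))"
    by (rule single_of_nat[symmetric])
  also have "\<dots> = 0" by (simp only: of_nat_card_eq_0 single_zero)
  finally show ?thesis .
qed

lemma char_power_card:
  fixes f :: "'p::prime_card laurent"
  shows "x \<in> chars f \<Longrightarrow> x (coset f g) ^ CARD('p) = 1"
  using char_of_nat[of x f "CARD('p)" g] by (simp add: of_nat_card_laurent char_zero)

lemma chars_eqI:
  assumes "x \<in> chars f" "y \<in> chars f" "\<And>g. x (coset f g) = y (coset f g)"
  shows "x = y"
  using assms by (intro extensionalityI[of x "range (coset f)" y]) (auto simp: chars_iff)

text \<open>Characters of the quotient are the characters of the additive group of Laurent polynomials that are trivial on the multiples of \<open>f\<close>.\<close>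

lemma char_exists:
  fixes \<eta> :: "'p::prime_card laurent \<Rightarrow> complex"
  assumes "\<And>g. norm (\<eta> g) = 1" "\<And>g h. \<eta> (g + h) = \<eta> g * \<eta> h" "\<And>g. f dvd g \<Longrightarrow> \<eta> g = 1"
  shows "\<exists>x\<in>chars f. \<forall>g. x (coset f g) = \<eta> g"
proof -
  define x where "x = (\<lambda>c\<in>range (coset f). \<eta> (SOME g. c = coset f g))"
  have x: "x (coset f g) = \<eta> g" for g
  proof -
    have "coset f g = coset f (SOME h. coset f g = coset f h)" by (rule someI) (rule refl)
    then have "f dvd g - (SOME h. coset f g = coset f h)" by (simp add: coset_eq_iff)
    then have "\<eta> (g - (SOME h. coset f g = coset f h)) = 1" by (rule assms(3))
    then have "\<eta> g = \<eta> (SOME h. coset f g = coset f h)"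
      using assms(2)[of "g - (SOME h. coset f g = coset f h)" "SOME h. coset f g = coset f h"] by simp
    then show ?thesis by (simp add: x_def)
  qed
  have "x \<in> chars f" using assms by (simp add: chars_iff x) (simp add: x_def)
  with x show ?thesis by blast
qed

text \<open>The multiples of \<open>f\<close> form a subspace over the prime field that does not contain \<open>g\<close>; a basis of it together with \<open>g\<close> extends to
a basis of the whole space.\<close>

lemma linear_functional_vanishing_on_multiples:
  fixes f g :: "'p::prime_card laurent"
  assumes "\<not> f dvd g"
  shows "\<exists>L :: 'p laurent \<Rightarrow> 'p mod_ring. (\<forall>a b. L (a + b) = L a + L b) \<and> (\<forall>a. f dvd a \<longrightarrow> L a = 0) \<and> L g = 1"
proof -
  let ?s = "\<lambda>(c :: 'p mod_ring) (v :: 'p laurent). Poly_Mapping.single 0 c * v"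
  interpret V: vector_space ?s
  proof
    fix a b :: "'p mod_ring" and x y :: "'p laurent"
    show "?s a (x + y) = ?s a x + ?s a y" by (simp add: distrib_left)
    show "?s (a + b) x = ?s a x + ?s b x" by (simp add: single_add distrib_right)
    show "?s a (?s b x) = ?s (a * b) x" by (simp add: mult_single flip: mult.assoc)
    show "?s 1 x = x" by simp
  qed
  interpret W: vector_space "(*) :: 'p mod_ring \<Rightarrow> 'p mod_ring \<Rightarrow> 'p mod_ring"
    by unfold_locales (simp_all add: algebra_simps)
  interpret P: vector_space_pair ?s "(*) :: 'p mod_ring \<Rightarrow> 'p mod_ring \<Rightarrow> 'p mod_ring" ..
  let ?S = "{a. f dvd a}"
  have sub: "V.subspace ?S" by (rule V.subspaceI) (auto intro: dvd_add)
  obtain B where B: "B \<subseteq> ?S" "V.independent B" "?S \<subseteq> V.span B" "card B = V.dim ?S"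
    by (rule V.basis_exists)
  have "V.span B \<subseteq> ?S" using B(1) sub by (rule V.span_minimal)
  with assms have g: "g \<notin> V.span B" by auto
  then have "V.independent (insert g B)" using B(2) by (rule V.independent_insertI)
  then obtain L where L: "Vector_Spaces.linear ?s (*) L" "\<forall>x\<in>insert g B. L x = (if x = g then 1 else 0)"
    using P.linear_independent_extend[of "insert g B" "\<lambda>x. if x = g then 1 else 0"] by auto
  interpret L: Vector_Spaces.linear ?s "(*)" L by (rule L(1))
  have gB: "g \<notin> B" using g V.span_base by blast
  have "L a = 0" if "f dvd a" for a
  proof (rule P.linear_eq_0_on_span[OF L(1)])
    show "L x = 0" if "x \<in> B" for x using L(2) that gB by auto
    show "a \<in> V.span B" using that B(3) by auto
  qed
  then show ?thesis using L(2) L.add by (intro exI[of _ L]) auto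
qed

lemma mod_ring_character:
  "\<exists>\<zeta> :: 'p::prime_card mod_ring \<Rightarrow> complex.
     (\<forall>a. norm (\<zeta> a) = 1) \<and> (\<forall>a b. \<zeta> (a + b) = \<zeta> a * \<zeta> b) \<and> \<zeta> 1 \<noteq> 1"
proof -
  let ?p = "CARD('p)"
  define z where "z = cis (2 * pi / ?p)"
  define \<zeta> where "\<zeta> a = z ^ nat (to_int_mod_ring a)" for a :: "'p mod_ring"
  have p: "1 < ?p" by (rule prime_gt_1_nat[OF prime_card])
  have zp: "z ^ ?p = 1" 
  proof -
    have "real ?p * (2 * pi / ?p) = 2 * pi" using p by simp
    then show ?thesis unfolding z_def by (metis Complex.DeMoivre cis_2pi)
  qed
  have mod: "z ^ (k mod ?p) = z ^ k" for k
  proof -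
    have "z ^ k = z ^ (?p * (k div ?p) + k mod ?p)" by simp
    also have "\<dots> = (z ^ ?p) ^ (k div ?p) * z ^ (k mod ?p)" by (simp only: power_add power_mult)
    finally show ?thesis by (simp add: zp)
  qed
  show ?thesis
  proof (intro exI[of _ \<zeta>] conjI allI)
    show "norm (\<zeta> a) = 1" for a by (simp add: \<zeta>_def z_def norm_power)
    show "\<zeta> (a + b) = \<zeta> a * \<zeta> b" for a b :: "'p mod_ring"
    proof -
      have nn: "0 \<le> to_int_mod_ring a" "0 \<le> to_int_mod_ring b" by (transfer, simp)+
      have "to_int_mod_ring (a + b) = (to_int_mod_ring a + to_int_mod_ring b) mod int ?p"
        by transfer auto
      then have "nat (to_int_mod_ring (a + b)) = (nat (to_int_mod_ring a) + nat (to_int_mod_ring b)) mod ?p"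
        using nn by (simp add: nat_mod_distrib nat_add_distrib)
      then show ?thesis by (simp add: \<zeta>_def mod power_add)
    qed
    have "\<zeta> 1 = z" using p by (simp add: \<zeta>_def)
    moreover have "z \<noteq> 1"
    proof
      assume "z = 1"
      then have "cos (2 * pi / ?p) = 1" by (simp add: z_def complex_eq_iff)
      then obtain k :: int where k: "2 * pi / ?p = real_of_int k * 2 * pi" unfolding cos_one_2pi_int ..
      then have "1 = real_of_int k * ?p" using p by (simp add: field_simps)
      then have "1 = k * int ?p" by (metis of_int_1 of_int_eq_iff of_int_mult of_int_of_nat_eq)
      then have "int ?p dvd 1" by (metis dvd_triv_right)
      then show False using p by simp
    qed
    ultimately show "\<zeta> 1 \<noteq> 1" by simp
  qed
qed

text \<open>Since the module is annihilated by \<open>p\<close>, separating characters are obtained by composing linear functionals to the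
prime field with a nontrivial character of that field.\<close>

lemma chars_separate:
  fixes f g :: "'p::prime_card laurent"
  assumes "\<not> f dvd g"
  obtains x where "x \<in> chars f" "x (coset f g) \<noteq> 1"
proof -
  obtain L :: "'p laurent \<Rightarrow> 'p mod_ring"
    where L: "\<forall>a b. L (a + b) = L a + L b" "\<forall>a. f dvd a \<longrightarrow> L a = 0" "L g = 1"
    using linear_functional_vanishing_on_multiples[OF assms] by blast
  obtain \<zeta> :: "'p mod_ring \<Rightarrow> complex"
    where \<zeta>: "\<forall>a. norm (\<zeta> a) = 1" "\<forall>a b. \<zeta> (a + b) = \<zeta> a * \<zeta> b" "\<zeta> 1 \<noteq> 1"
    using mod_ring_character by blast
  have "\<zeta> (0 + 0) = \<zeta> 0 * \<zeta> 0" using \<zeta>(2) by blast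
  moreover have "norm (\<zeta> 0) = 1" using \<zeta>(1) by blast
  ultimately have "\<zeta> 0 = 1" by auto
  then have "\<exists>x\<in>chars f. \<forall>a. x (coset f a) = \<zeta> (L a)"
    using \<zeta> L by (intro char_exists) auto
  then obtain x where "x \<in> chars f" "\<And>a. x (coset f a) = \<zeta> (L a)" by blast
  then show thesis using \<zeta>(3) L(3) by (intro that[of x]) auto
qed

definition char_mult :: "'p::prime_card laurent \<Rightarrow> ('p laurent set \<Rightarrow> complex) \<Rightarrow> ('p laurent set \<Rightarrow> complex) \<Rightarrow> ('p laurent set \<Rightarrow> complex)" where
  "char_mult f x y = x \<otimes>\<^bsub>dual_group (quot_group f)\<^esub> y"

lemma char_mult_eval: "char_mult f x y (coset f g) = x (coset f g) * y (coset f g)"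
  by (simp add: char_mult_def dual_group_def circle_group_def carrier_quot_ring)

lemma char_mult_closed: "x \<in> chars f \<Longrightarrow> y \<in> chars f \<Longrightarrow> char_mult f x y \<in> chars f"
  unfolding chars_iff char_mult_eval
  by (auto simp: norm_mult) (simp add: char_mult_def dual_group_def carrier_quot_ring)

lemma alg_action_eval: "alg_action f n x (coset f g) = x (coset f (Poly_Mapping.single n 1 * g))"
  by (simp add: alg_action_def dual_map_def carrier_quot_ring monom_mult_coset)

lemma alg_action_closed: "x \<in> chars f \<Longrightarrow> alg_action f n x \<in> chars f"
  unfolding chars_iff alg_action_eval
  by (auto simp: distrib_left) (simp add: alg_action_def dual_map_def carrier_quot_ring)

lemma alg_action_inverse:
  assumes "x \<in> chars f"
  shows "alg_action f (- n) (alg_action f n x) = x"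
  by (rule chars_eqI[of _ f]) (auto simp: assms alg_action_closed alg_action_eval mult_single simp flip: mult.assoc)

text \<open>The sets \<open>\<alpha>\<^sup>-\<^sup>n(A)\<close> are preimages under \<open>\<alpha>\<^sup>n\<close>, because the action is by bijections.\<close>

lemma alg_action_image:
  assumes "A \<subseteq> chars f"
  shows "alg_action f (- n) ` A = {x \<in> chars f. alg_action f n x \<in> A}"
proof (intro equalityI subsetI)
  fix y assume "y \<in> alg_action f (- n) ` A"
  then obtain x where x: "x \<in> A" "y = alg_action f (- n) x" by auto
  then show "y \<in> {x \<in> chars f. alg_action f n x \<in> A}"
    using assms alg_action_closed[of x f "- n"] alg_action_inverse[of x f "- n"] by auto
next
  fix y assume "y \<in> {x \<in> chars f. alg_action f n x \<in> A}"
  then show "y \<in> alg_action f (- n) ` A"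
    using alg_action_inverse[of y f n] by (metis (mono_tags, lifting) image_eqI mem_Collect_eq)
qed

section \<open>Haar measure and characters\<close>

abbreviation haar :: "'p::prime_card laurent \<Rightarrow> ('p laurent set \<Rightarrow> complex) measure \<Rightarrow> bool" where
  "haar f \<mu> \<equiv> is_haar_prob (dual_group (quot_group f)) (dual_topology (quot_group f)) \<mu>"

definition cylinder :: "'p::prime_card laurent \<Rightarrow> ('p laurent \<times> complex) set \<Rightarrow> ('p laurent set \<Rightarrow> complex) set" where
  "cylinder f Q = {x \<in> chars f. \<forall>q\<in>Q. x (coset f (fst q)) = snd q}"

definition cylinders :: "'p::prime_card laurent \<Rightarrow> ('p laurent set \<Rightarrow> complex) set set" where
  "cylinders f = {cylinder f Q | Q. finite Q}"

lemma countable_laurent: "countable (UNIV :: 'p::prime_card laurent set)"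
proof -
  let ?G = "\<lambda>g :: 'p laurent. (\<lambda>k. (k, Poly_Mapping.lookup g k)) ` Poly_Mapping.keys g"
  have "inj ?G"
  proof (rule injI, rule poly_mapping_eqI)
    fix g h :: "'p laurent" and k
    assume eq: "?G g = ?G h"
    have 1: "Poly_Mapping.lookup h k = Poly_Mapping.lookup g k" if "k \<in> Poly_Mapping.keys g"
    proof -
      have "(k, Poly_Mapping.lookup g k) \<in> ?G h" unfolding eq[symmetric] using that by (rule imageI)
      then show ?thesis by auto
    qed
    have 2: "Poly_Mapping.lookup h k = Poly_Mapping.lookup g k" if "k \<in> Poly_Mapping.keys h"
    proof -
      have "(k, Poly_Mapping.lookup h k) \<in> ?G g" unfolding eq using that by (rule imageI)
      then show ?thesis by auto
    qed
    show "Poly_Mapping.lookup g k = Poly_Mapping.lookup h k"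
    proof (cases "k \<in> Poly_Mapping.keys g \<or> k \<in> Poly_Mapping.keys h")
      case True
      then show ?thesis by (elim disjE) (auto dest: 1 2)
    next
      case False
      then show ?thesis by (simp add: in_keys_iff)
    qed
  qed
  moreover have "countable ((UNIV :: (int \<times> int) set) \<times> (UNIV :: 'p mod_ring set))"
    by (intro countable_SIGMA countableI_type countable_finite) simp
  then have "countable (UNIV :: ((int \<times> int) \<times> 'p mod_ring) set)" by simp
  then have "countable {S. finite S \<and> S \<subseteq> (UNIV :: ((int \<times> int) \<times> 'p mod_ring) set)}"
    by (rule countable_Collect_finite_subset)
  then have "countable (range ?G)"
    by (rule countable_subset[rotated]) (simp add: image_subset_iff)
  ultimately show ?thesis using countable_image_inj_on by blast
qed

abbreviation roots_p :: "nat \<Rightarrow> complex set" where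
  "roots_p p \<equiv> {z. z ^ p = 1}"

lemma finite_roots_card: "finite (roots_p CARD('p::prime_card))"
  using finite_roots_unity[of "CARD('p)"] prime_gt_0_nat[OF prime_card[where 'a='p]] by simp

lemma cylinders_Pow: "cylinders f \<subseteq> Pow (chars f)"
  by (auto simp: cylinders_def cylinder_def)

lemma cylinders_Int_stable: "Int_stable (cylinders f)"
proof (rule Int_stableI)
  fix a b assume a: "a \<in> cylinders f" and b: "b \<in> cylinders f"
  obtain Q where Q: "a = cylinder f Q" "finite Q" using a unfolding cylinders_def by blast
  obtain R where R: "b = cylinder f R" "finite R" using b unfolding cylinders_def by blast
  have "a \<inter> b = cylinder f (Q \<union> R)"
    unfolding Q(1) R(1) cylinder_def by auto
  moreover have "finite (Q \<union> R)" using Q(2) R(2) by simp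
  ultimately show "a \<inter> b \<in> cylinders f" unfolding cylinders_def mem_Collect_eq by blast
qed

lemma chars_in_cylinders: "chars f \<in> cylinders f"
  unfolding cylinders_def by (rule CollectI, rule exI[of _ "{}"]) (simp add: cylinder_def)

lemma haar_space: "haar f \<mu> \<Longrightarrow> space \<mu> = chars f"
  by (simp only: is_haar_prob_def chars_def)

lemma haar_prob: "haar f \<mu> \<Longrightarrow> prob_space \<mu>"
  by (simp only: is_haar_prob_def)

lemma haar_sets_open: "haar f \<mu> \<Longrightarrow> sets \<mu> = sigma_sets (chars f) {U. openin (dual_topology (quot_group f)) U}"
  by (simp only: is_haar_prob_def chars_def)

lemma dual_topology_eq:
  "dual_topology (quot_group f) =
     subtopology (product_topology (\<lambda>_. top_of_set (sphere 0 1)) (range (coset f))) (chars f)"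
  unfolding dual_topology_def chars_def by (simp add: circle_group_def carrier_quot_ring)

text \<open>Together with complements this shows that the level sets of a character evaluation are measurable.\<close>

lemma open_char_neq: "openin (dual_topology (quot_group f)) {x \<in> chars f. x (coset f g) \<noteq> w}"
proof -
  let ?T = "product_topology (\<lambda>_. top_of_set (sphere (0::complex) 1)) (range (coset f))"
  have "openin (top_of_set (sphere 0 1)) (sphere 0 1 - {w})"
    by (metis openin_delete openin_topspace topspace_euclidean_subtopology t1_space_euclidean t1_space_subtopology)
  then have "openin ?T {x \<in> topspace ?T. x (coset f g) \<in> sphere 0 1 - {w}}"
    by (intro openin_continuous_map_preimage[OF continuous_map_product_projection]) auto
  moreover have "{x \<in> chars f. x (coset f g) \<noteq> w}
      = {x \<in> topspace ?T. x (coset f g) \<in> sphere 0 1 - {w}} \<inter> chars f"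
    by (auto simp: chars_iff PiE_iff)
  ultimately show ?thesis unfolding dual_topology_eq openin_subtopology by blast
qed

lemma open_contains_cylinder:
  fixes f :: "'p::prime_card laurent"
  assumes U: "openin (dual_topology (quot_group f)) U" and x: "x \<in> U"
  obtains Q where "finite Q" "Q \<subseteq> UNIV \<times> roots_p CARD('p)" "x \<in> cylinder f Q" "cylinder f Q \<subseteq> U"
proof -
  let ?I = "range (coset f)"
  obtain S where S: "openin (product_topology (\<lambda>_. top_of_set (sphere (0::complex) 1)) ?I) S" "U = S \<inter> chars f"
    using U unfolding dual_topology_eq openin_subtopology by blast
  have xS: "x \<in> S" "x \<in> chars f" using x S(2) by auto
  let ?sph = "\<lambda>_ :: 'p laurent set. top_of_set (sphere (0::complex) 1)"
  have "\<exists>V. finite {i \<in> ?I. V i \<noteq> topspace (?sph i)} \<and> (\<forall>i\<in>?I. openin (?sph i) (V i)) \<and>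
     x \<in> Pi\<^sub>E ?I V \<and> Pi\<^sub>E ?I V \<subseteq> S"
    by (rule openin_product_topology_alt[THEN iffD1, OF S(1), rule_format, OF xS(1)])
  then obtain V where V: "finite {i \<in> ?I. V i \<noteq> topspace (?sph i)}" "x \<in> Pi\<^sub>E ?I V" "Pi\<^sub>E ?I V \<subseteq> S"
    by (elim exE conjE) (rule that)
  have "\<exists>G\<subseteq>UNIV. finite G \<and> {i \<in> ?I. V i \<noteq> topspace (?sph i)} = coset f ` G"
    by (rule finite_subset_image[OF V(1)]) blast
  then obtain G where G: "finite G" "{i \<in> ?I. V i \<noteq> topspace (?sph i)} = coset f ` G"
    by (elim exE conjE) (rule that)
  define Q where "Q = (\<lambda>g. (g, x (coset f g))) ` G"
  show thesis
  proof (rule that[of Q])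
    show "finite Q" using G(1) by (simp add: Q_def)
    show "Q \<subseteq> UNIV \<times> roots_p CARD('p)" using char_power_card[OF xS(2)] by (auto simp: Q_def)
    show "x \<in> cylinder f Q" using xS(2) by (auto simp: Q_def cylinder_def)
    show "cylinder f Q \<subseteq> U"
    proof
      fix y assume "y \<in> cylinder f Q"
      then have y: "y \<in> chars f" "\<And>g. g \<in> G \<Longrightarrow> y (coset f g) = x (coset f g)"
        by (auto simp: cylinder_def Q_def)
      have "y (coset f g) \<in> V (coset f g)" for g
      proof (cases "coset f g \<in> coset f ` G")
        case True
        then have "y (coset f g) = x (coset f g)" using y(2) by auto
        then show ?thesis using V(2) by auto
      next
        case False
        then have "V (coset f g) = sphere 0 1" using G(2) by auto
        then show ?thesis using norm_char[OF y(1), of g] by simp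
      qed
      moreover have "y \<in> extensional ?I" using y(1) by (simp add: chars_iff)
      ultimately have "y \<in> Pi\<^sub>E ?I V" by (auto simp: PiE_iff)
      then show "y \<in> U" using V(3) S(2) y(1) by blast
    qed
  qed
qed

text \<open>Values of characters are \<open>p\<close>-th roots of unity, so the dual group is zero-dimensional: every open set is a union of cylinders
that prescribe finitely many values, and only countably many cylinders are needed because there are countably many Laurent polynomials.\<close>

lemma haar_sets_cylinders:
  fixes f :: "'p::prime_card laurent"
  assumes H: "haar f \<mu>"
  shows "sets \<mu> = sigma_sets (chars f) (cylinders f)"
proof (intro equalityI)
  let ?O = "{U. openin (dual_topology (quot_group f)) U}"
  interpret S: sigma_algebra "chars f" "sets \<mu>"
    using sets.sigma_algebra_axioms[of \<mu>] haar_space[OF H] by simp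
  have single: "{x \<in> chars f. x (coset f g) = w} \<in> sets \<mu>" for g w
  proof -
    have "{x \<in> chars f. x (coset f g) \<noteq> w} \<in> sets \<mu>"
      unfolding haar_sets_open[OF H] using open_char_neq by (intro sigma_sets.Basic) blast
    then have "chars f - {x \<in> chars f. x (coset f g) \<noteq> w} \<in> sets \<mu>" by (rule S.compl_sets)
    moreover have "chars f - {x \<in> chars f. x (coset f g) \<noteq> w} = {x \<in> chars f. x (coset f g) = w}" by auto
    ultimately show ?thesis by simp
  qed
  have cyl: "cylinder f Q \<in> sets \<mu>" if "finite Q" for Q
    using that
  proof (induction Q)
    case empty
    show ?case using S.top by (simp add: cylinder_def)
  next
    case (insert q Q)
    obtain g w where q: "q = (g, w)" by (cases q)
    have "cylinder f (insert q Q) = {x \<in> chars f. x (coset f g) = w} \<inter> cylinder f Q"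
      by (auto simp: cylinder_def q)
    with insert.IH single show ?case by auto
  qed
  then have "cylinders f \<subseteq> sets \<mu>" by (auto simp: cylinders_def)
  then show "sigma_sets (chars f) (cylinders f) \<subseteq> sets \<mu>" by (rule S.sigma_sets_subset)
  interpret C: sigma_algebra "chars f" "sigma_sets (chars f) (cylinders f)"
    by (rule sigma_algebra_sigma_sets[OF cylinders_Pow])
  have "U \<in> sigma_sets (chars f) (cylinders f)" if U: "openin (dual_topology (quot_group f)) U" for U
  proof -
    let ?B = "{Q. (finite Q \<and> Q \<subseteq> UNIV \<times> roots_p CARD('p)) \<and> cylinder f Q \<subseteq> U}"
    have "countable {Q. finite Q \<and> Q \<subseteq> (UNIV :: 'p laurent set) \<times> roots_p CARD('p)}"
      by (intro countable_Collect_finite_subset countable_SIGMA countable_laurent countable_finite finite_roots_card)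
    then have "countable ?B" by (rule countable_subset[rotated]) blast
    moreover have "cylinder f ` ?B \<subseteq> sigma_sets (chars f) (cylinders f)"
      by (auto simp: cylinders_def intro!: sigma_sets.Basic)
    ultimately have "(\<Union>Q\<in>?B. cylinder f Q) \<in> sigma_sets (chars f) (cylinders f)"
      by (rule C.countable_UN')
    moreover have "U = (\<Union>Q\<in>?B. cylinder f Q)"
    proof
      show "U \<subseteq> (\<Union>Q\<in>?B. cylinder f Q)"
      proof
        fix x assume x: "x \<in> U"
        obtain Q where "finite Q" "Q \<subseteq> UNIV \<times> roots_p CARD('p)" "x \<in> cylinder f Q" "cylinder f Q \<subseteq> U"
          using open_contains_cylinder[OF U x] .
        then show "x \<in> (\<Union>Q\<in>?B. cylinder f Q)" by (intro UN_I[of Q]) auto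
      qed
      show "(\<Union>Q\<in>?B. cylinder f Q) \<subseteq> U" by (rule UN_least) simp
    qed
    ultimately show ?thesis by simp
  qed
  then show "sets \<mu> \<subseteq> sigma_sets (chars f) (cylinders f)"
    unfolding haar_sets_open[OF H] by (intro C.sigma_sets_subset) auto
qed

lemma cylinder_sets: "haar f \<mu> \<Longrightarrow> A \<in> cylinders f \<Longrightarrow> A \<in> sets \<mu>"
  by (simp add: haar_sets_cylinders sigma_sets.Basic)

definition level :: "'p::prime_card laurent \<Rightarrow> 'p laurent \<Rightarrow> complex \<Rightarrow> ('p laurent set \<Rightarrow> complex) set" where
  "level f g w = {x \<in> chars f. x (coset f g) = w}"

lemma level_cylinder: "level f g w \<in> cylinders f"
  unfolding cylinders_def by (rule CollectI, rule exI[of _ "{(g, w)}"]) (simp add: level_def cylinder_def)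

lemma level_sets: "haar f \<mu> \<Longrightarrow> level f g w \<in> sets \<mu>"
  by (rule cylinder_sets[OF _ level_cylinder])

lemma char_inverse:
  assumes "y \<in> chars f"
  shows "\<exists>z\<in>chars f. \<forall>g. z (coset f g) = inverse (y (coset f g))"
  using assms by (intro char_exists) (auto simp: norm_inverse norm_char char_add char_dvd)

lemma level_translate:
  assumes H: "haar f \<mu>" and y: "y \<in> chars f"
  shows "measure \<mu> (level f g (w * y (coset f g))) = measure \<mu> (level f g w)"
proof -
  obtain z where z: "z \<in> chars f" "\<And>g. z (coset f g) = inverse (y (coset f g))"
    using char_inverse[OF y] by blast
  have "y <#\<^bsub>dual_group (quot_group f)\<^esub> level f g w = char_mult f y ` level f g w"
    unfolding l_coset_def char_mult_def by blast
  also have "\<dots> = level f g (w * y (coset f g))"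
  proof (intro equalityI subsetI)
    fix x assume "x \<in> char_mult f y ` level f g w"
    then show "x \<in> level f g (w * y (coset f g))"
      using y by (auto simp: level_def char_mult_closed char_mult_eval)
  next
    fix x assume x: "x \<in> level f g (w * y (coset f g))"
    have "x = char_mult f y (char_mult f z x)"
      using x y z char_nonzero[OF y] by (intro chars_eqI[of _ f]) (auto simp: level_def char_mult_closed char_mult_eval)
    moreover have "char_mult f z x \<in> level f g w"
      using x z char_nonzero[OF y] by (auto simp: level_def char_mult_closed char_mult_eval)
    ultimately show "x \<in> char_mult f y ` level f g w" by blast
  qed
  finally have "y <#\<^bsub>dual_group (quot_group f)\<^esub> level f g w = level f g (w * y (coset f g))" .
  moreover have "emeasure \<mu> (y <#\<^bsub>dual_group (quot_group f)\<^esub> level f g w) = emeasure \<mu> (level f g w)"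
    using H level_sets[OF H] y unfolding is_haar_prob_def chars_def by blast
  ultimately show ?thesis by (simp add: measure_def)
qed

text \<open>Orthogonality of characters. If \<open>f\<close> does not divide \<open>g\<close>, pick a character \<open>y\<close> with \<open>y(g) \<noteq> 1\<close>; translation by \<open>y\<close> preserves the
measure and multiplies the integral by \<open>y(g)\<close>. The integral is written as a finite sum over the level sets, so invariance is
used for these sets only.\<close>

lemma char_integral:
  fixes f :: "'p::prime_card laurent"
  assumes H: "haar f \<mu>"
  shows "has_bochner_integral \<mu> (\<lambda>x. x (coset f g)) (if f dvd g then 1 else 0)"
proof -
  interpret prob_space \<mu> by (rule haar_prob[OF H])
  let ?Z = "roots_p CARD('p)"
  have "has_bochner_integral \<mu> (\<lambda>x. \<Sum>w\<in>?Z. indicator (level f g w) x *\<^sub>R w) (\<Sum>w\<in>?Z. measure \<mu> (level f g w) *\<^sub>R w)"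
    by (intro has_bochner_integral_sum has_bochner_integral_indicator level_sets[OF H]) (simp add: emeasure_eq_measure)
  moreover have "(\<Sum>w\<in>?Z. indicator (level f g w) x *\<^sub>R w) = x (coset f g)" if "x \<in> space \<mu>" for x
  proof -
    have x: "x \<in> chars f" using that by (simp add: haar_space[OF H])
    have "(\<Sum>w\<in>?Z. indicator (level f g w) x *\<^sub>R w) = (\<Sum>w\<in>?Z. if x (coset f g) = w then w else 0)"
      using x by (intro sum.cong) (auto simp: level_def indicator_def)
    also have "\<dots> = x (coset f g)"
      using finite_roots_card[where 'p='p] char_power_card[OF x, of g] by (simp add: sum.delta)
    finally show ?thesis .
  qed
  ultimately have hb: "has_bochner_integral \<mu> (\<lambda>x. x (coset f g)) (\<Sum>w\<in>?Z. measure \<mu> (level f g w) *\<^sub>R w)"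
    by (simp cong: has_bochner_integral_cong)
  show ?thesis
  proof (cases "f dvd g")
    case True
    have "has_bochner_integral \<mu> (\<lambda>x. x (coset f g)) (1::complex)"
    proof (subst has_bochner_integral_cong[OF refl _ refl])
      show "x (coset f g) = 1" if "x \<in> space \<mu>" for x
        using that char_dvd[OF _ True] by (simp add: haar_space[OF H])
      show "has_bochner_integral \<mu> (\<lambda>_. 1) (1::complex)"
        using has_bochner_integral_integrable[of \<mu> "\<lambda>_. 1::complex"] by (simp add: prob_space)
    qed
    with True show ?thesis by simp
  next
    case False
    obtain y where y: "y \<in> chars f" "y (coset f g) \<noteq> 1" using chars_separate[OF False] .
    let ?\<omega> = "y (coset f g)" and ?I = "\<Sum>w\<in>?Z. measure \<mu> (level f g w) *\<^sub>R w"
    have \<omega>: "?\<omega> ^ CARD('p) = 1" "?\<omega> \<noteq> 0" using char_power_card[OF y(1)] char_nonzero[OF y(1)] by auto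
    have "?I = (\<Sum>w\<in>?Z. measure \<mu> (level f g (w * ?\<omega>)) *\<^sub>R (w * ?\<omega>))"
      by (rule sum.reindex_bij_witness[of _ "\<lambda>w. w * ?\<omega>" "\<lambda>w. w / ?\<omega>"])
         (use \<omega> in \<open>auto simp: power_divide power_mult_distrib\<close>)
    also have "\<dots> = ?I * ?\<omega>"
      unfolding level_translate[OF H y(1)] sum_distrib_right by (intro sum.cong) auto
    finally have "?I * (?\<omega> - 1) = 0" by (simp add: algebra_simps)
    with y(2) have "?I = 0" by simp
    with hb False show ?thesis by simp
  qed
qed

section \<open>Trigonometric polynomials and mixing\<close>

text \<open>Trigonometric polynomials, the finite linear combinations of characters of the dual group. They form an algebra that
contains the indicator functions of cylinders.\<close>

definition trig :: "'p::prime_card laurent \<Rightarrow> (('p laurent set \<Rightarrow> complex) \<Rightarrow> complex) \<Rightarrow> bool" where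
  "trig f h \<longleftrightarrow> (\<exists>S c. finite S \<and> (\<forall>x\<in>chars f. h x = (\<Sum>g\<in>S. c g * x (coset f g))))"

lemma trig_cong: "trig f h \<Longrightarrow> (\<And>x. x \<in> chars f \<Longrightarrow> k x = h x) \<Longrightarrow> trig f k"
  unfolding trig_def by simp

lemma trig_char: "trig f (\<lambda>x. a * x (coset f g))"
  unfolding trig_def by (intro exI[of _ "{g}"] exI[of _ "\<lambda>_. a"]) simp

lemma trig_const: "trig f (\<lambda>_. a)"
  by (rule trig_cong[OF trig_char[of f a 0]]) (simp add: char_zero)

lemma trig_add:
  assumes "trig f h" "trig f k"
  shows "trig f (\<lambda>x. h x + k x)"
proof -
  obtain S c where S: "finite S" "\<And>x. x \<in> chars f \<Longrightarrow> h x = (\<Sum>g\<in>S. c g * x (coset f g))"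
    using assms(1) unfolding trig_def by blast
  obtain T d where T: "finite T" "\<And>x. x \<in> chars f \<Longrightarrow> k x = (\<Sum>g\<in>T. d g * x (coset f g))"
    using assms(2) unfolding trig_def by blast
  let ?e = "\<lambda>g. (if g \<in> S then c g else 0) + (if g \<in> T then d g else 0)"
  have "h x + k x = (\<Sum>g\<in>S \<union> T. ?e g * x (coset f g))" if x: "x \<in> chars f" for x
  proof -
    have "(\<Sum>g\<in>S \<union> T. (if g \<in> S then c g else 0) * x (coset f g)) = (\<Sum>g\<in>S. c g * x (coset f g))"
      using S(1) T(1) by (intro sum.mono_neutral_cong_right) auto
    moreover have "(\<Sum>g\<in>S \<union> T. (if g \<in> T then d g else 0) * x (coset f g)) = (\<Sum>g\<in>T. d g * x (coset f g))"
      using S(1) T(1) by (intro sum.mono_neutral_cong_right) auto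
    ultimately show ?thesis by (simp add: S(2)[OF x] T(2)[OF x] distrib_right sum.distrib)
  qed
  moreover have "finite (S \<union> T)" using S(1) T(1) by simp
  ultimately show ?thesis unfolding trig_def by (intro exI[of _ "S \<union> T"] exI[of _ ?e]) simp
qed

lemma trig_sum: "(\<And>i. i \<in> I \<Longrightarrow> trig f (h i)) \<Longrightarrow> trig f (\<lambda>x. \<Sum>i\<in>I. h i x)"
proof (induction I rule: infinite_finite_induct)
  case (insert i I)
  then show ?case by (simp add: trig_add)
qed (simp_all add: trig_const)

lemma trig_mult:
  assumes "trig f h" "trig f k"
  shows "trig f (\<lambda>x. h x * k x)"
proof -
  obtain S c where S: "finite S" "\<And>x. x \<in> chars f \<Longrightarrow> h x = (\<Sum>g\<in>S. c g * x (coset f g))"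
    using assms(1) unfolding trig_def by blast
  obtain T d where T: "finite T" "\<And>x. x \<in> chars f \<Longrightarrow> k x = (\<Sum>g\<in>T. d g * x (coset f g))"
    using assms(2) unfolding trig_def by blast
  have "trig f (\<lambda>x. \<Sum>g\<in>S. \<Sum>g'\<in>T. (c g * d g') * x (coset f (g + g')))"
    by (intro trig_sum trig_char)
  then show ?thesis
    by (rule trig_cong) (simp add: S(2) T(2) sum_product char_add mult_ac)
qed

lemma roots_of_unity_power_sum:
  fixes z :: complex
  assumes "z ^ p = 1"
  shows "(\<Sum>k<p. z ^ k) = (if z = 1 then of_nat p else 0)"
  using assms by (simp add: geometric_sum)

text \<open>The indicator of the condition \<open>x(g) = w\<close> is the average of the powers of \<open>x(g) / w\<close>, by the vanishing of sums of powers of nontrivial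
roots of unity.\<close>

lemma trig_level:
  fixes f :: "'p::prime_card laurent"
  shows "trig f (indicator (level f g w))"
proof (cases "w ^ CARD('p) = 1")
  case True
  let ?p = "CARD('p)"
  have p: "0 < ?p" using prime_gt_0_nat[OF prime_card[where 'a='p]] .
  have w: "w \<noteq> 0" using True p by (auto simp: power_0_left)
  have "trig f (\<lambda>x. \<Sum>k<?p. (1 / (of_nat ?p * w ^ k)) * x (coset f (of_nat k * g)))"
    by (intro trig_sum trig_char)
  then show ?thesis
  proof (rule trig_cong)
    fix x assume x: "x \<in> chars f"
    have "(\<Sum>k<?p. (1 / (of_nat ?p * w ^ k)) * x (coset f (of_nat k * g)))
        = (1 / of_nat ?p) * (\<Sum>k<?p. (x (coset f g) / w) ^ k)"
      by (simp add: char_of_nat[OF x] sum_distrib_left power_divide)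
    also have "\<dots> = (1 / of_nat ?p) * (if x (coset f g) / w = 1 then of_nat ?p else 0)"
      using char_power_card[OF x, of g] True by (subst roots_of_unity_power_sum) (simp_all add: power_divide)
    also have "\<dots> = indicator (level f g w) x"
      using x w p by (auto simp: level_def indicator_def divide_eq_1_iff)
    finally show "indicator (level f g w) x = (\<Sum>k<?p. (1 / (of_nat ?p * w ^ k)) * x (coset f (of_nat k * g)))"
      by simp
  qed
next
  case False
  have "level f g w = {}" using False char_power_card[of _ f g] by (auto simp: level_def)
  then show ?thesis using trig_const[of f 0] by (rule_tac trig_cong) auto
qed

lemma trig_cylinder:
  assumes "A \<in> cylinders f"
  shows "trig f (indicator A)"
proof -
  obtain Q where "A = cylinder f Q" "finite Q" using assms unfolding cylinders_def by blast
  moreover have "trig f (indicator (cylinder f Q))" if "finite Q" for Q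
    using that
  proof (induction Q)
    case empty
    show ?case by (rule trig_cong[OF trig_const[of f 1]]) (simp add: cylinder_def)
  next
    case (insert q Q)
    have "trig f (\<lambda>x. indicator (level f (fst q) (snd q)) x * indicator (cylinder f Q) x)"
      by (intro trig_mult trig_level insert.IH)
    then show ?case
      by (rule trig_cong) (auto simp: cylinder_def level_def indicator_def)
  qed
  ultimately show ?thesis by simp
qed

lemma trig_integral:
  assumes H: "haar f \<mu>" and S: "\<And>x. x \<in> chars f \<Longrightarrow> h x = (\<Sum>g\<in>S. c g * x (coset f g))"
  shows "has_bochner_integral \<mu> h (\<Sum>g\<in>S. c g * (if f dvd g then 1 else 0))"
proof (subst has_bochner_integral_cong[OF refl _ refl])
  show "h x = (\<Sum>g\<in>S. c g * x (coset f g))" if "x \<in> space \<mu>" for x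
    using that S haar_space[OF H] by simp
  show "has_bochner_integral \<mu> (\<lambda>x. \<Sum>g\<in>S. c g * x (coset f g)) (\<Sum>g\<in>S. c g * (if f dvd g then 1 else 0))"
    by (intro has_bochner_integral_sum has_bochner_integral_mult_right char_integral[OF H])
qed

text \<open>The dual form of mixing along the shifts \<open>n j s\<close>: a fixed nontrivial tuple of module elements satisfies the shifted linear relation
for only finitely many \<open>j\<close>.\<close>

definition no_relations :: "'p::prime_card laurent \<Rightarrow> (nat \<Rightarrow> 'i \<Rightarrow> int \<times> int) \<Rightarrow> 'i set \<Rightarrow> bool" where
  "no_relations f n I \<longleftrightarrow> (\<forall>\<gamma>. (\<exists>s\<in>I. \<not> f dvd \<gamma> s) \<longrightarrow>
     eventually (\<lambda>j. \<not> f dvd (\<Sum>s\<in>I. Poly_Mapping.single (n j s) 1 * \<gamma> s)) sequentially)"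

text \<open>Multiplying out, both sides become sums over tuples \<open>\<gamma>\<close> of frequencies, and by orthogonality the terms are weighted by whether \<open>f\<close> divides the
shifted sum of \<open>\<gamma>\<close> on the left, and by whether it divides every \<open>\<gamma> s\<close> on the right. These agree for all large \<open>j\<close>, uniformly in the finitely many tuples that occur.\<close>

lemma trig_mixing:
  fixes f :: "'p::prime_card laurent" and n :: "nat \<Rightarrow> 'i \<Rightarrow> int \<times> int"
  assumes H: "haar f \<mu>" and I: "finite I" and h: "\<And>s. s \<in> I \<Longrightarrow> trig f (h s)"
    and n: "no_relations f n I"
  shows "eventually (\<lambda>j. (\<integral>x. (\<Prod>s\<in>I. h s (alg_action f (n j s) x)) \<partial>\<mu>) = (\<Prod>s\<in>I. \<integral>x. h s x \<partial>\<mu>)) sequentially"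
proof -
  have "\<forall>s\<in>I. \<exists>Sc. finite (fst Sc) \<and> (\<forall>x\<in>chars f. h s x = (\<Sum>g\<in>fst Sc. snd Sc g * x (coset f g)))"
    using h unfolding trig_def by fastforce
  from bchoice[OF this] obtain Sc where Sc:
    "\<forall>s\<in>I. finite (fst (Sc s)) \<and> (\<forall>x\<in>chars f. h s x = (\<Sum>g\<in>fst (Sc s). snd (Sc s) g * x (coset f g)))" ..
  define S where "S = (\<lambda>s. fst (Sc s))"
  define c where "c = (\<lambda>s. snd (Sc s))"
  have S: "\<And>s. s \<in> I \<Longrightarrow> finite (S s)"
    and hS: "\<And>s x. s \<in> I \<Longrightarrow> x \<in> chars f \<Longrightarrow> h s x = (\<Sum>g\<in>S s. c s g * x (coset f g))"
    using Sc unfolding S_def c_def by blast+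
  let ?P = "PiE I S"
  let ?m = "\<lambda>j \<gamma>. \<Sum>s\<in>I. Poly_Mapping.single (n j s) 1 * \<gamma> s"
  let ?d = "\<lambda>g. if f dvd g then 1 else 0 :: complex"
  have fin: "finite ?P" using I S by (rule finite_PiE)
  have lhs: "(\<integral>x. (\<Prod>s\<in>I. h s (alg_action f (n j s) x)) \<partial>\<mu>) = (\<Sum>\<gamma>\<in>?P. (\<Prod>s\<in>I. c s (\<gamma> s)) * ?d (?m j \<gamma>))" for j
  proof -
    have eq: "(\<Prod>s\<in>I. h s (alg_action f (n j s) x)) = (\<Sum>\<gamma>\<in>?P. (\<Prod>s\<in>I. c s (\<gamma> s)) * x (coset f (?m j \<gamma>)))"
      if x: "x \<in> chars f" for x
    proof -
      have "(\<Prod>s\<in>I. h s (alg_action f (n j s) x))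
          = (\<Prod>s\<in>I. \<Sum>g\<in>S s. c s g * x (coset f (Poly_Mapping.single (n j s) 1 * g)))"
        by (intro prod.cong refl) (simp add: hS alg_action_closed[OF x] alg_action_eval)
      also have "\<dots> = (\<Sum>\<gamma>\<in>?P. \<Prod>s\<in>I. c s (\<gamma> s) * x (coset f (Poly_Mapping.single (n j s) 1 * \<gamma> s)))"
        by (rule prod_sum_PiE[OF I S])
      also have "\<dots> = (\<Sum>\<gamma>\<in>?P. (\<Prod>s\<in>I. c s (\<gamma> s)) * x (coset f (?m j \<gamma>)))"
        by (simp add: prod.distrib char_sum[OF x])
      finally show ?thesis .
    qed
    have "has_bochner_integral \<mu> (\<lambda>x. \<Prod>s\<in>I. h s (alg_action f (n j s) x)) (\<Sum>\<gamma>\<in>?P. (\<Prod>s\<in>I. c s (\<gamma> s)) * ?d (?m j \<gamma>))"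
    proof (subst has_bochner_integral_cong[OF refl _ refl])
      show "(\<Prod>s\<in>I. h s (alg_action f (n j s) x)) = (\<Sum>\<gamma>\<in>?P. (\<Prod>s\<in>I. c s (\<gamma> s)) * x (coset f (?m j \<gamma>)))"
        if "x \<in> space \<mu>" for x using that eq haar_space[OF H] by simp
      show "has_bochner_integral \<mu> (\<lambda>x. \<Sum>\<gamma>\<in>?P. (\<Prod>s\<in>I. c s (\<gamma> s)) * x (coset f (?m j \<gamma>)))
          (\<Sum>\<gamma>\<in>?P. (\<Prod>s\<in>I. c s (\<gamma> s)) * ?d (?m j \<gamma>))"
        by (intro has_bochner_integral_sum has_bochner_integral_mult_right char_integral[OF H])
    qed
    then show ?thesis by (rule has_bochner_integral_integral_eq)
  qed
  have rhs: "(\<Prod>s\<in>I. \<integral>x. h s x \<partial>\<mu>) = (\<Sum>\<gamma>\<in>?P. (\<Prod>s\<in>I. c s (\<gamma> s)) * (\<Prod>s\<in>I. ?d (\<gamma> s)))"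
  proof -
    have "(\<Prod>s\<in>I. \<integral>x. h s x \<partial>\<mu>) = (\<Prod>s\<in>I. \<Sum>g\<in>S s. c s g * ?d g)"
      by (intro prod.cong refl has_bochner_integral_integral_eq trig_integral[OF H] hS)
    also have "\<dots> = (\<Sum>\<gamma>\<in>?P. \<Prod>s\<in>I. c s (\<gamma> s) * ?d (\<gamma> s))"
      by (rule prod_sum_PiE[OF I S])
    finally show ?thesis by (simp only: prod.distrib)
  qed
  have ev: "eventually (\<lambda>j. ?d (?m j \<gamma>) = (\<Prod>s\<in>I. ?d (\<gamma> s))) sequentially" for \<gamma>
  proof (cases "\<exists>s\<in>I. \<not> f dvd \<gamma> s")
    case True
    then have "(\<Prod>s\<in>I. ?d (\<gamma> s)) = 0" using I by (simp only: prod_zero_iff) auto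
    moreover have "eventually (\<lambda>j. \<not> f dvd ?m j \<gamma>) sequentially"
      using n True unfolding no_relations_def by blast
    ultimately show ?thesis by (auto elim: eventually_mono)
  next
    case False
    then have "f dvd ?m j \<gamma>" for j by (intro dvd_sum dvd_mult) blast
    moreover have "(\<Prod>s\<in>I. ?d (\<gamma> s)) = 1" using False by (intro prod.neutral) auto
    ultimately show ?thesis by simp
  qed
  have "eventually (\<lambda>j. \<forall>\<gamma>\<in>?P. ?d (?m j \<gamma>) = (\<Prod>s\<in>I. ?d (\<gamma> s))) sequentially"
    by (intro eventually_ball_finite[OF fin] ballI ev)
  then show ?thesis
    unfolding lhs rhs by (rule eventually_mono) (intro sum.cong refl arg_cong[where f = "\<lambda>y. _ * y"], blast)
qed

lemma alg_action_measurable: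
  assumes H: "haar f \<mu>"
  shows "alg_action f n \<in> measurable \<mu> \<mu>"
proof (rule measurable_sigma_sets[OF haar_sets_cylinders[OF H] cylinders_Pow])
  show "alg_action f n \<in> space \<mu> \<rightarrow> chars f" by (auto simp: haar_space[OF H] alg_action_closed)
  fix A assume "A \<in> cylinders f"
  then obtain Q where Q: "A = cylinder f Q" "finite Q" unfolding cylinders_def by blast
  have "alg_action f n -` A \<inter> space \<mu> = cylinder f ((\<lambda>q. (Poly_Mapping.single n 1 * fst q, snd q)) ` Q)"
    unfolding Q(1) haar_space[OF H] cylinder_def by (auto simp: alg_action_closed alg_action_eval)
  also have "\<dots> \<in> cylinders f" unfolding cylinders_def using Q(2) by blast
  finally show "alg_action f n -` A \<inter> space \<mu> \<in> sets \<mu>" using cylinder_sets[OF H] by blast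
qed

definition joint_event ::
  "'p::prime_card laurent \<Rightarrow> ('i \<Rightarrow> int \<times> int) \<Rightarrow> 'i set \<Rightarrow> ('i \<Rightarrow> ('p laurent set \<Rightarrow> complex) set) \<Rightarrow> ('p laurent set \<Rightarrow> complex) set" where
  "joint_event f n I A = {x \<in> chars f. \<forall>s\<in>I. alg_action f (n s) x \<in> A s}"

lemma joint_event_sets:
  assumes H: "haar f \<mu>" and I: "finite I" and A: "\<And>s. s \<in> I \<Longrightarrow> A s \<in> sets \<mu>"
  shows "joint_event f n I A \<in> sets \<mu>"
proof -
  have "{x \<in> space \<mu>. alg_action f (n s) x \<in> A s} \<in> sets \<mu>" if "s \<in> I" for s
    using measurable_sets[OF alg_action_measurable[OF H] A[OF that], of "n s"]
    by (simp add: vimage_def Int_def conj_commute)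
  then have "{x \<in> space \<mu>. \<forall>s\<in>I. alg_action f (n s) x \<in> A s} \<in> sets \<mu>"
    using I by (intro sets.sets_Collect_finite_All) auto
  then show ?thesis by (simp add: joint_event_def haar_space[OF H])
qed

lemma cylinder_mixing:
  fixes f :: "'p::prime_card laurent" and n :: "nat \<Rightarrow> 'i \<Rightarrow> int \<times> int"
  assumes H: "haar f \<mu>" and I: "finite I" and A: "\<And>s. s \<in> I \<Longrightarrow> A s \<in> cylinders f"
    and n: "no_relations f n I"
  shows "eventually (\<lambda>j. measure \<mu> (joint_event f (n j) I A) = (\<Prod>s\<in>I. measure \<mu> (A s))) sequentially"
proof -
  interpret prob_space \<mu> by (rule haar_prob[OF H])
  have ind: "(\<integral>x. indicator B x \<partial>\<mu>) = complex_of_real (measure \<mu> B)" if "B \<in> sets \<mu>" for B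
  proof -
    have "has_bochner_integral \<mu> (\<lambda>x. indicator B x *\<^sub>R (1::complex)) (measure \<mu> B *\<^sub>R 1)"
      using that by (intro has_bochner_integral_indicator) (simp_all add: emeasure_eq_measure)
    moreover have "(\<lambda>x. indicator B x *\<^sub>R (1::complex)) = indicator B"
      by (auto simp: indicator_def fun_eq_iff)
    ultimately show ?thesis
      by (simp only: has_bochner_integral_integral_eq scaleR_conv_of_real mult_1_right)
  qed
  have A': "A s \<in> sets \<mu>" if "s \<in> I" for s using cylinder_sets[OF H A[OF that]] .
  have J: "(\<integral>x. (\<Prod>s\<in>I. indicator (A s) (alg_action f (n j s) x)) \<partial>\<mu>)
      = complex_of_real (measure \<mu> (joint_event f (n j) I A))" for j
  proof -
    have "(\<integral>x. (\<Prod>s\<in>I. indicator (A s) (alg_action f (n j s) x)) \<partial>\<mu>)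
       = (\<integral>x. (indicator (joint_event f (n j) I A) x :: complex) \<partial>\<mu>)"
    proof (rule Bochner_Integration.integral_cong[OF refl])
      fix x assume "x \<in> space \<mu>"
      then have "x \<in> chars f" by (simp add: haar_space[OF H])
      then show "(\<Prod>s\<in>I. indicator (A s) (alg_action f (n j s) x)) = (indicator (joint_event f (n j) I A) x :: complex)"
        using I by (auto simp: joint_event_def indicator_def prod_zero_iff)
    qed
    with ind[OF joint_event_sets[OF H I A']] show ?thesis by simp
  qed
  have "eventually (\<lambda>j. (\<integral>x. (\<Prod>s\<in>I. indicator (A s) (alg_action f (n j s) x)) \<partial>\<mu>)
      = (\<Prod>s\<in>I. \<integral>x. (indicator (A s) x :: complex) \<partial>\<mu>)) sequentially"
    by (rule trig_mixing[OF H I trig_cylinder[OF A] n])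
  then show ?thesis
  proof (rule eventually_mono)
    fix j assume "(\<integral>x. (\<Prod>s\<in>I. indicator (A s) (alg_action f (n j s) x)) \<partial>\<mu>)
      = (\<Prod>s\<in>I. \<integral>x. (indicator (A s) x :: complex) \<partial>\<mu>)"
    then have "complex_of_real (measure \<mu> (joint_event f (n j) I A)) = (\<Prod>s\<in>I. complex_of_real (measure \<mu> (A s)))"
      unfolding J by (simp add: ind A' cong: prod.cong)
    then show "measure \<mu> (joint_event f (n j) I A) = (\<Prod>s\<in>I. measure \<mu> (A s))"
      by (simp only: of_real_prod[symmetric] of_real_eq_iff)
  qed
qed


text \<open>Multiplication by a monomial preserves divisibility by \<open>f\<close>, so a single constant shift has no relations; cylinder mixing along it says that the measure of cylinders is preserved.\<close>

lemma alg_action_measure_preserving: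
  assumes H: "haar f \<mu>" and B: "B \<in> sets \<mu>"
  shows "measure \<mu> {x \<in> chars f. alg_action f n x \<in> B} = measure \<mu> B"
proof -
  interpret prob_space \<mu> by (rule haar_prob[OF H])
  have no_rel: "no_relations f (\<lambda>(_::nat) _. n) {()}"
    unfolding no_relations_def
  proof (intro allI impI always_eventually)
    fix \<gamma> :: "unit \<Rightarrow> 'a laurent"
    assume "\<exists>s\<in>{()}. \<not> f dvd \<gamma> s"
    then have nd: "\<not> f dvd \<gamma> ()" by simp
    show "\<not> f dvd (\<Sum>s\<in>{()}. Poly_Mapping.single n 1 * \<gamma> s)"
    proof
      assume "f dvd (\<Sum>s\<in>{()}. Poly_Mapping.single n 1 * \<gamma> s)"
      then have "f dvd Poly_Mapping.single (- n) 1 * (Poly_Mapping.single n 1 * \<gamma> ())" by (simp add: dvd_mult)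
      with nd show False by (simp add: mult_single mult.assoc[symmetric])
    qed
  qed
  have cyl: "measure \<mu> {x \<in> chars f. alg_action f n x \<in> A} = measure \<mu> A" if "A \<in> cylinders f" for A
  proof -
    have "eventually (\<lambda>j::nat. measure \<mu> (joint_event f (\<lambda>_. n) {()} (\<lambda>_. A)) = (\<Prod>s\<in>{()}. measure \<mu> A)) sequentially"
      by (rule cylinder_mixing[OF H _ that no_rel]) simp
    then show ?thesis by (simp add: joint_event_def)
  qed
  have "\<mu> = distr \<mu> \<mu> (alg_action f n)"
  proof (rule measure_eqI_generator_eq[OF cylinders_Int_stable cylinders_Pow, where A = "\<lambda>_. chars f"])
    fix A assume A: "A \<in> cylinders f"
    have "emeasure (distr \<mu> \<mu> (alg_action f n)) A = emeasure \<mu> (alg_action f n -` A \<inter> space \<mu>)"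
      by (rule emeasure_distr[OF alg_action_measurable[OF H] cylinder_sets[OF H A]])
    also have "alg_action f n -` A \<inter> space \<mu> = {x \<in> chars f. alg_action f n x \<in> A}"
      by (auto simp: haar_space[OF H])
    finally show "emeasure \<mu> A = emeasure (distr \<mu> \<mu> (alg_action f n)) A"
      by (simp add: emeasure_eq_measure cyl[OF A])
  qed (auto simp: haar_sets_cylinders[OF H] chars_in_cylinders emeasure_eq_measure)
  then have "measure \<mu> B = measure (distr \<mu> \<mu> (alg_action f n)) B" by simp
  also have "\<dots> = measure \<mu> (alg_action f n -` B \<inter> space \<mu>)"
    by (rule measure_distr[OF alg_action_measurable[OF H] B])
  also have "alg_action f n -` B \<inter> space \<mu> = {x \<in> chars f. alg_action f n x \<in> B}"
    by (auto simp: haar_space[OF H])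
  finally show ?thesis by simp
qed

text \<open>Mixing passes from cylinders to all measurable sets, one index at a time, by induction over the generation of the sigma-algebra. For
disjoint unions the limit is exchanged with the sum by Tannery's theorem, the bound being supplied by invariance.\<close>

lemma mixing_all_sets:
  fixes f :: "'p::prime_card laurent" and n :: "nat \<Rightarrow> 'i \<Rightarrow> int \<times> int"
  assumes H: "haar f \<mu>" and I: "finite I" and n: "no_relations f n I"
    and A: "\<And>s. s \<in> I \<Longrightarrow> A s \<in> sets \<mu>"
  shows "(\<lambda>j. measure \<mu> (joint_event f (n j) I A)) \<longlonglongrightarrow> (\<Prod>s\<in>I. measure \<mu> (A s))"
proof -
  interpret prob_space \<mu> by (rule haar_prob[OF H])
  define L where "L = (\<lambda>A. (\<lambda>j. measure \<mu> (joint_event f (n j) I A)) \<longlonglongrightarrow> (\<Prod>s\<in>I. measure \<mu> (A s)))"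
  have "\<forall>A. (\<forall>s\<in>I. A s \<in> sets \<mu>) \<longrightarrow> (\<forall>s\<in>I - J. A s \<in> cylinders f) \<longrightarrow> L A" if "finite J" for J
    using that
  proof (induction J)
    case empty
    show ?case
    proof (intro allI impI)
      fix A assume "\<forall>s\<in>I - {}. A s \<in> cylinders f"
      then have "eventually (\<lambda>j. measure \<mu> (joint_event f (n j) I A) = (\<Prod>s\<in>I. measure \<mu> (A s))) sequentially"
        by (intro cylinder_mixing[OF H I _ n]) simp
      then show "L A" unfolding L_def by (rule tendsto_eventually)
    qed
  next
    case (insert s0 J)
    show ?case
    proof (cases "s0 \<in> I")
      case False
      then have "I - insert s0 J = I - J" by auto
      with insert.IH show ?thesis by simp
    next
      case s0: True
      show ?thesis
      proof (intro allI impI)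
        fix A assume A: "\<forall>s\<in>I. A s \<in> sets \<mu>" and cyl: "\<forall>s\<in>I - insert s0 J. A s \<in> cylinders f"
        \<comment> \<open>Only the set with index \<open>s0\<close> varies; the induction hypothesis covers the case that it is a cylinder.\<close>
        let ?A = "\<lambda>B. A(s0 := B)"
        let ?c = "\<Prod>s\<in>I - {s0}. measure \<mu> (A s)"
        let ?J = "\<lambda>j B. joint_event f (n j) I (?A B)"
        have prod: "(\<Prod>s\<in>I. measure \<mu> (?A B s)) = measure \<mu> B * ?c" for B
          by (subst prod.remove[OF I s0]) (auto intro!: prod.cong)
        have LI: "L (?A B) \<longleftrightarrow> (\<lambda>j. measure \<mu> (?J j B)) \<longlonglongrightarrow> measure \<mu> B * ?c" for B
          unfolding L_def prod by (rule refl)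
        have J_sets: "?J j B \<in> sets \<mu>" if "B \<in> sets \<mu>" for j B
          using A that by (intro joint_event_sets[OF H I]) simp
        have sets: "B \<in> sets \<mu>" if "B \<in> sigma_sets (chars f) (cylinders f)" for B
          using that by (simp add: haar_sets_cylinders[OF H])
        have L_cyl: "L (?A B)" if "B \<in> cylinders f" for B
        proof (rule insert.IH[rule_format])
          show "?A B s \<in> sets \<mu>" if "s \<in> I" for s using A \<open>B \<in> cylinders f\<close> that cylinder_sets[OF H] by simp
          show "?A B s \<in> cylinders f" if "s \<in> I - J" for s using cyl \<open>B \<in> cylinders f\<close> that by simp
        qed
        have "A s0 \<in> sigma_sets (chars f) (cylinders f)"
          using A s0 by (simp add: haar_sets_cylinders[OF H, symmetric])
        with cylinders_Int_stable cylinders_Pow have "L (?A (A s0))"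
        proof (induction rule: sigma_sets_induct_disjoint)
          case (basic B)
          then show ?case by (rule L_cyl)
        next
          case empty
          have "?J j {} = {}" for j using s0 by (auto simp: joint_event_def)
          then show ?case unfolding LI by simp
        next
          case (compl B)
          have B: "B \<in> sets \<mu>" and top: "chars f \<in> sets \<mu>"
            using sets[OF compl.hyps] cylinder_sets[OF H chars_in_cylinders] by auto
          have B_sub: "B \<subseteq> chars f" using sets.sets_into_space[OF B] by (simp add: haar_space[OF H])
          have "?J j (chars f - B) = ?J j (chars f) - ?J j B" for j
            using s0 by (auto simp: joint_event_def split: if_splits)
          moreover have "?J j B \<subseteq> ?J j (chars f)" for j
            using s0 B_sub by (auto simp: joint_event_def alg_action_closed split: if_splits)
          ultimately have J: "measure \<mu> (?J j (chars f - B)) = measure \<mu> (?J j (chars f)) - measure \<mu> (?J j B)" for j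
            using finite_measure_Diff[OF J_sets[OF top] J_sets[OF B]] by simp
          have "(\<lambda>j. measure \<mu> (?J j (chars f)) - measure \<mu> (?J j B))
              \<longlonglongrightarrow> measure \<mu> (chars f) * ?c - measure \<mu> B * ?c"
            using L_cyl[OF chars_in_cylinders] compl.IH unfolding LI by (rule tendsto_diff)
          moreover have "measure \<mu> (chars f) * ?c - measure \<mu> B * ?c = measure \<mu> (chars f - B) * ?c"
            using finite_measure_Diff[OF top B B_sub] by (simp add: left_diff_distrib)
          ultimately show ?case unfolding LI J by simp
        next
          case (union B)
          have B: "B k \<in> sets \<mu>" for k using union.hyps(2) sets by blast
          have sums_B: "(\<lambda>k. measure \<mu> (B k)) sums measure \<mu> (\<Union>k. B k)"
            using union.hyps(1) B by (intro finite_measure_UNION) auto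
          have J_sums: "(\<lambda>k. measure \<mu> (?J j (B k))) sums measure \<mu> (?J j (\<Union>k. B k))" for j
          proof -
            have "(\<Union>k. ?J j (B k)) = ?J j (\<Union>k. B k)"
              using s0 by (auto simp: joint_event_def split: if_splits)
            moreover have "disjoint_family (\<lambda>k. ?J j (B k))"
              unfolding disjoint_family_on_def
            proof (intro ballI impI)
              fix k l :: nat assume "k \<noteq> l"
              then have "B k \<inter> B l = {}" using union.hyps(1) by (auto simp: disjoint_family_on_def)
              then show "?J j (B k) \<inter> ?J j (B l) = {}"
                using s0 by (auto simp: joint_event_def split: if_splits)
            qed
            moreover have "range (\<lambda>k. ?J j (B k)) \<subseteq> sets \<mu>" using J_sets[OF B] by blast
            ultimately show ?thesis using finite_measure_UNION[of "\<lambda>k. ?J j (B k)"] by simp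
          qed
          have bound: "measure \<mu> (?J j (B k)) \<le> measure \<mu> (B k)" for j k
          proof -
            have "?J j (B k) \<subseteq> {x \<in> chars f. alg_action f (n j s0) x \<in> B k}"
              using s0 by (auto simp: joint_event_def)
            moreover have "{x \<in> chars f. alg_action f (n j s0) x \<in> B k} \<in> sets \<mu>"
              using joint_event_sets[OF H, of "{()}" "\<lambda>_. B k" "\<lambda>_. n j s0"] B by (simp add: joint_event_def)
            ultimately have "measure \<mu> (?J j (B k)) \<le> measure \<mu> {x \<in> chars f. alg_action f (n j s0) x \<in> B k}"
              by (rule finite_measure_mono)
            then show ?thesis unfolding alg_action_measure_preserving[OF H B] .
          qed
          have J_lim: "(\<lambda>j. measure \<mu> (?J j (B k))) \<longlonglongrightarrow> measure \<mu> (B k) * ?c" for k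
            using union.IH unfolding LI by blast
          have "(\<lambda>j. suminf (\<lambda>k. measure \<mu> (?J j (B k)))) \<longlonglongrightarrow> suminf (\<lambda>k. measure \<mu> (B k) * ?c)"
          proof (rule tannerys_theorem[THEN conjunct2, THEN conjunct2])
            show "eventually (\<lambda>(k, j). norm (measure \<mu> (?J j (B k))) \<le> measure \<mu> (B k)) (at_top \<times>\<^sub>F sequentially)"
              using bound by (intro always_eventually) auto
            show "summable (\<lambda>k. measure \<mu> (B k))" using sums_B by (rule sums_summable)
          qed (simp_all add: J_lim)
          moreover have "suminf (\<lambda>k. measure \<mu> (?J j (B k))) = measure \<mu> (?J j (\<Union>k. B k))" for j
            using J_sums by (rule sums_unique[symmetric])
          moreover have "suminf (\<lambda>k. measure \<mu> (B k) * ?c) = measure \<mu> (\<Union>k. B k) * ?c"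
            using sums_mult2[OF sums_B] by (rule sums_unique[symmetric])
          ultimately show ?case unfolding LI by simp
        qed
        then show "L A" by simp
      qed
    qed
  qed
  from this[OF I] show ?thesis using A unfolding L_def by simp
qed

section \<open>Mixing below the number of vertices\<close>

text \<open>Indices whose coefficient is divisible by \<open>f\<close> contribute multiples of \<open>f\<close> and are discarded first.\<close>

lemma no_relations_of_gon:
  fixes f :: "'p::prime_card laurent" and n :: "nat \<Rightarrow> 'i \<Rightarrow> int \<times> int"
  assumes f: "Factorial_Ring.irreducible f" and R: "is_gon R (newton_polygon f)"
    and I: "finite I" "card I < R"
    and n: "\<And>s t. s \<in> I \<Longrightarrow> t \<in> I \<Longrightarrow> s \<noteq> t \<Longrightarrow> filterlim (\<lambda>j. n j s - n j t) cofinite sequentially"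
  shows "no_relations f n I"
  unfolding no_relations_def
proof (intro allI impI)
  fix \<gamma> :: "'i \<Rightarrow> 'p laurent" assume ex: "\<exists>s\<in>I. \<not> f dvd \<gamma> s"
  define T where "T = {s \<in> I. \<not> f dvd \<gamma> s}"
  have T: "T \<subseteq> I" "finite T" "T \<noteq> {}" using ex I(1) by (auto simp: T_def)
  have "card T < R" using card_mono[OF I(1) T(1)] I(2) by simp
  moreover have "filterlim (\<lambda>j. n j s - n j t) cofinite sequentially" if "s \<in> T" "t \<in> T" "s \<noteq> t" for s t
    using that T(1) by (intro n) auto
  moreover have "\<not> f dvd \<gamma> t" if "t \<in> T" for t using that by (simp add: T_def)
  ultimately have "eventually (\<lambda>j. \<not> f dvd (\<Sum>t\<in>T. Poly_Mapping.single (n j t) 1 * \<gamma> t)) sequentially"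
    using eventually_no_relation[OF f R T(2,3)] by blast
  then show "eventually (\<lambda>j. \<not> f dvd (\<Sum>s\<in>I. Poly_Mapping.single (n j s) 1 * \<gamma> s)) sequentially"
  proof (rule eventually_mono)
    fix j
    let ?g = "\<lambda>s. Poly_Mapping.single (n j s) 1 * \<gamma> s"
    have "(\<Sum>s\<in>I. ?g s) = (\<Sum>s\<in>I - T. ?g s) + (\<Sum>s\<in>T. ?g s)"
      using I(1) T(1) by (rule sum.subset_diff[OF _ _, rotated])
    moreover have "f dvd (\<Sum>s\<in>I - T. ?g s)"
      by (intro dvd_sum dvd_mult) (simp add: T_def)
    ultimately show "\<not> f dvd (\<Sum>s\<in>T. ?g s) \<Longrightarrow> \<not> f dvd (\<Sum>s\<in>I. ?g s)"
      by (simp add: dvd_add_right_iff)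
  qed
qed

lemma Inter_action_eq_joint_event:
  assumes "I \<noteq> {}" "\<And>s. s \<in> I \<Longrightarrow> A s \<subseteq> chars f"
  shows "(\<Inter>s\<in>I. alg_action f (- n s) ` A s) = joint_event f n I A"
  using assms by (auto simp: alg_action_image joint_event_def)

theorem mixing_below_number_of_vertices:
  fixes f :: "'p::prime_card laurent"
  assumes f: "Factorial_Ring.irreducible f" and R: "is_gon R (newton_polygon f)" and H: "haar f \<mu>"
    and r: "1 \<le> r" "r < R"
  shows "mixing_of_order \<mu> (alg_action f) r"
  unfolding mixing_of_order_def
proof (intro allI impI)
  fix n :: "nat \<Rightarrow> nat \<Rightarrow> int \<times> int" and A :: "nat \<Rightarrow> ('p laurent set \<Rightarrow> complex) set"
  assume n: "\<forall>s\<in>{1..r}. \<forall>t\<in>{1..r}. s \<noteq> t \<longrightarrow> filterlim (\<lambda>j. n j s - n j t) cofinite sequentially"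
    and A: "\<forall>s\<in>{1..r}. A s \<in> sets \<mu>"
  have "no_relations f n {1..r}"
    using n r by (intro no_relations_of_gon[OF f R]) auto
  then have "(\<lambda>j. measure \<mu> (joint_event f (n j) {1..r} A)) \<longlonglongrightarrow> (\<Prod>s\<in>{1..r}. measure \<mu> (A s))"
    using A by (intro mixing_all_sets[OF H]) auto
  moreover have "(\<Inter>s\<in>{1..r}. alg_action f (- n j s) ` A s) = joint_event f (n j) {1..r} A" for j
  proof (rule Inter_action_eq_joint_event)
    show "A s \<subseteq> chars f" if "s \<in> {1..r}" for s
      using sets.sets_into_space[of "A s" \<mu>] A that by (simp add: haar_space[OF H])
  qed (use r in auto)
  ultimately show "(\<lambda>j. measure \<mu> (\<Inter>s\<in>{1..r}. alg_action f (- n j s) ` A s)) \<longlonglongrightarrow> (\<Prod>s\<in>{1..r}. measure \<mu> (A s))"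
    by simp
qed

section \<open>Failure of mixing along dilates of the support\<close>

lemma CHAR_laurent: "CHAR('p::prime_card laurent) = CARD('p)"
proof (rule CHAR_eqI)
  show "of_nat CARD('p) = (0 :: 'p laurent)" by (rule of_nat_card_laurent)
  fix k assume "of_nat k = (0 :: 'p laurent)"
  then have "Poly_Mapping.single 0 (of_nat k) = (0 :: 'p laurent)" by simp
  then have "of_nat k = (0 :: 'p mod_ring)" by (simp only: single_eq_0)
  then show "CARD('p) dvd k" by (rule of_nat_0_mod_ring_dvd)
qed

lemma frobenius_laurent:
  fixes f :: "'p::prime_card laurent"
  shows "f ^ (CARD('p) ^ j) = (\<Sum>k\<in>Poly_Mapping.keys f.
     Poly_Mapping.single (zscale (int (CARD('p) ^ j)) k) (Poly_Mapping.lookup f k ^ (CARD('p) ^ j)))"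
proof -
  have "f ^ (CARD('p) ^ j) = (\<Sum>k\<in>Poly_Mapping.keys f. Poly_Mapping.single k (Poly_Mapping.lookup f k)) ^ (CARD('p) ^ j)"
    by (simp only: poly_mapping_sum_single)
  also have "\<dots> = (\<Sum>k\<in>Poly_Mapping.keys f. Poly_Mapping.single k (Poly_Mapping.lookup f k) ^ (CARD('p) ^ j))"
    by (rule freshmans_dream_sum') (simp_all add: CHAR_laurent prime_card)
  finally show ?thesis by (simp only: single_power)
qed

text \<open>Scalars from the prime field act as multiples by natural numbers.\<close>

lemma char_scalar:
  fixes f :: "'p::prime_card laurent"
  assumes x: "x \<in> chars f" and g: "x (coset f g) = 1"
  shows "x (coset f (Poly_Mapping.single 0 c * g)) = 1"
proof -
  have "0 \<le> to_int_mod_ring c" by transfer simp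
  then have "c = of_nat (nat (to_int_mod_ring c))"
    by (simp add: of_nat_of_int_mod_ring)
  then obtain k where "c = of_nat k" by (rule that)
  then have "Poly_Mapping.single 0 c * g = of_nat k * g" by (simp only: single_of_nat)
  with x g show ?thesis by (simp add: char_of_nat)
qed

lemma char_monomial_scalar:
  fixes f :: "'p::prime_card laurent"
  assumes x: "x \<in> chars f" and c: "c \<noteq> 0"
  shows "x (coset f (Poly_Mapping.single a c)) = 1 \<longleftrightarrow> x (coset f (Poly_Mapping.single a 1)) = 1"
proof
  assume "x (coset f (Poly_Mapping.single a c)) = 1"
  from char_scalar[OF x this, of "inverse c"] c show "x (coset f (Poly_Mapping.single a 1)) = 1"
    by (simp add: mult_single)
next
  assume "x (coset f (Poly_Mapping.single a 1)) = 1"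
  from char_scalar[OF x this, of c] show "x (coset f (Poly_Mapping.single a c)) = 1"
    by (simp add: mult_single)
qed

text \<open>A character is trivial on \<open>f ^ (p ^ j)\<close>, whose support is \<open>p\<^sup>j \<cdot> S(f)\<close>. The nonzero coefficients are harmless by \<open>char_monomial_scalar\<close>.\<close>

lemma frobenius_relation:
  fixes f :: "'p::prime_card laurent"
  assumes x: "x \<in> chars f" and e: "e \<in> Poly_Mapping.keys f"
    and others: "\<And>k. k \<in> Poly_Mapping.keys f \<Longrightarrow> k \<noteq> e \<Longrightarrow>
      x (coset f (Poly_Mapping.single (zscale (int (CARD('p) ^ j)) k) 1)) = 1"
  shows "x (coset f (Poly_Mapping.single (zscale (int (CARD('p) ^ j)) e) 1)) = 1"
proof -
  let ?q = "CARD('p) ^ j"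
  let ?m = "\<lambda>k. Poly_Mapping.single (zscale (int ?q) k) (Poly_Mapping.lookup f k ^ ?q)"
  have c: "Poly_Mapping.lookup f k ^ ?q \<noteq> 0" if "k \<in> Poly_Mapping.keys f" for k
    using that by (simp add: in_keys_iff)
  have "f dvd f ^ ?q" using prime_gt_0_nat[OF prime_card[where 'a='p]] by (intro dvd_power) simp
  then have "1 = x (coset f (f ^ ?q))" using char_dvd[OF x] by simp
  also have "\<dots> = (\<Prod>k\<in>Poly_Mapping.keys f. x (coset f (?m k)))"
    unfolding frobenius_laurent by (rule char_sum[OF x])
  also have "\<dots> = x (coset f (?m e)) * (\<Prod>k\<in>Poly_Mapping.keys f - {e}. x (coset f (?m k)))"
    using e by (intro prod.remove) auto
  also have "(\<Prod>k\<in>Poly_Mapping.keys f - {e}. x (coset f (?m k))) = 1"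
  proof (rule prod.neutral, rule ballI)
    fix k assume "k \<in> Poly_Mapping.keys f - {e}"
    then have k: "k \<in> Poly_Mapping.keys f" "k \<noteq> e" by auto
    show "x (coset f (?m k)) = 1" using others[OF k] char_monomial_scalar[OF x c[OF k(1)]] by (rule iffD2[rotated])
  qed
  finally have "x (coset f (?m e)) = 1" by simp
  then show ?thesis using char_monomial_scalar[OF x c[OF e]] by (rule iffD1[rotated])
qed

lemma filterlim_inj_cofinite:
  assumes "inj (v :: nat \<Rightarrow> 'a)"
  shows "filterlim v cofinite sequentially"
  unfolding filterlim_iff cofinite_eq_sequentially[symmetric] eventually_cofinite
proof (intro allI impI)
  fix P :: "'a \<Rightarrow> bool" assume "finite {x. \<not> P x}"
  from finite_vimageI[OF this assms] show "finite {j. \<not> P (v j)}" by (simp add: vimage_def)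
qed

text \<open>All nonempty level sets are translates of each other and finitely many cover the group, so none is a null set; and there are at least two.\<close>

lemma level_one_measure:
  fixes f :: "'p::prime_card laurent"
  assumes H: "haar f \<mu>" and g: "\<not> f dvd g"
  shows "0 < measure \<mu> (level f g 1)" "measure \<mu> (level f g 1) < 1"
proof -
  interpret prob_space \<mu> by (rule haar_prob[OF H])
  show "0 < measure \<mu> (level f g 1)"
  proof (rule ccontr)
    assume "\<not> 0 < measure \<mu> (level f g 1)"
    then have zero: "measure \<mu> (level f g 1) = 0" using measure_nonneg[of \<mu> "level f g 1"] by linarith
    have "measure \<mu> (level f g w) = 0" for w
    proof (cases "level f g w = {}")
      case False
      then obtain y where "y \<in> chars f" "y (coset f g) = w" by (auto simp: level_def)
      with level_translate[OF H, where y = y and g = g and w = 1] zero show ?thesis by simp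
    qed simp
    moreover have "chars f = (\<Union>w\<in>roots_p CARD('p). level f g w)"
      using char_power_card[of _ f g] by (auto simp: level_def)
    ultimately have "measure \<mu> (chars f) \<le> 0"
    proof -
      have "level f g ` roots_p CARD('p) \<subseteq> sets \<mu>" using level_sets[OF H] by blast
      from finite_measure_subadditive_finite[OF finite_roots_card[where 'p='p] this] show ?thesis
        using \<open>\<And>w. measure \<mu> (level f g w) = 0\<close> \<open>chars f = _\<close> by simp
    qed
    then show False using prob_space by (simp add: haar_space[OF H])
  qed
  show "measure \<mu> (level f g 1) < 1"
  proof (rule ccontr)
    assume "\<not> measure \<mu> (level f g 1) < 1"
    then have one: "measure \<mu> (level f g 1) = 1" using prob_le_1[of "level f g 1"] by linarith
    obtain y where y: "y \<in> chars f" "y (coset f g) \<noteq> 1" using chars_separate[OF g] .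
    have "measure \<mu> (level f g (y (coset f g))) = 1" using level_translate[OF H y(1), where g = g and w = 1] one by simp
    moreover have disj: "level f g 1 \<inter> level f g (y (coset f g)) = {}" using y(2) by (auto simp: level_def)
    ultimately have "measure \<mu> (level f g 1 \<union> level f g (y (coset f g))) = 2"
      using finite_measure_Union[OF level_sets[OF H] level_sets[OF H] disj] one by simp
    then show False using prob_le_1[of "level f g 1 \<union> level f g (y (coset f g))"] by simp
  qed
qed

text \<open>Enumerate the support as \<open>e 1, \<dots>, e s\<close>, continue with further lattice points up to index \<open>r\<close>, and shift by \<open>p\<^sup>j \<cdot> e t\<close>. The sets
ask for \<open>x(1) \<noteq> 1\<close> at the first point of the support, for \<open>x(1) = 1\<close> at the other points of the support, and for nothing at the extra points. Their joint event is
empty for every \<open>j\<close>, although each of them has positive measure.\<close>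

theorem not_mixing_of_order_card_support:
  fixes f :: "'p::prime_card laurent"
  assumes f: "Factorial_Ring.irreducible f" and H: "haar f \<mu>" and r: "card (Poly_Mapping.keys f) \<le> r"
  shows "\<not> mixing_of_order \<mu> (alg_action f) r"
proof
  assume mix: "mixing_of_order \<mu> (alg_action f) r"
  interpret prob_space \<mu> by (rule haar_prob[OF H])
  let ?S = "Poly_Mapping.keys f" and ?p = "CARD('p)"
  let ?s = "card ?S"
  have f1: "\<not> f dvd 1" "f \<noteq> 0" using f by (auto simp: Factorial_Ring.irreducible_def)
  then have s: "1 \<le> ?s" by (simp add: Suc_le_eq card_gt_0_iff)
  have p: "1 < ?p" by (rule prime_gt_1_nat[OF prime_card])
  obtain e0 where e0: "bij_betw e0 {1..?s} ?S"
    using ex_bij_betw_nat_finite_1[OF finite_keys] by blast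
  have "infinite (- ?S)" using finite_compl[of ?S] by (simp add: finite_prod)
  then have "\<exists>e1 :: nat \<Rightarrow> int \<times> int. inj e1 \<and> range e1 \<subseteq> - ?S" by (rule infinite_countable_subset)
  then obtain e1 :: "nat \<Rightarrow> int \<times> int" where e1: "inj e1" "range e1 \<subseteq> - ?S" by blast
  define e where "e t = (if t \<in> {1..?s} then e0 t else e1 t)" for t
  have e0_S: "e0 t \<in> ?S" if "t \<in> {1..?s}" for t using e0 that by (rule bij_betwE[rule_format])
  have e1_S: "e1 t \<notin> ?S" for t using e1(2) by auto
  have "inj e"
  proof (rule injI)
    fix t t' assume eq: "e t = e t'"
    consider "t \<in> {1..?s}" "t' \<in> {1..?s}" | "t \<notin> {1..?s}" "t' \<notin> {1..?s}"
      using eq e0_S[of t] e0_S[of t'] e1_S[of t] e1_S[of t'] unfolding e_def by (metis (full_types))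
    then show "t = t'"
    proof cases
      case 1
      then show ?thesis using eq inj_onD[OF bij_betw_imp_inj_on[OF e0]] by (simp add: e_def)
    next
      case 2
      then show ?thesis using eq injD[OF e1(1)] unfolding e_def by presburger
    qed
  qed
  then have e_inj: "e t \<noteq> e t'" if "t \<noteq> t'" for t t' using that by (simp add: inj_eq)
  define n where "n j t = zscale (int (?p ^ j)) (e t)" for j t
  have n: "filterlim (\<lambda>j. n j t - n j t') cofinite sequentially" if "t \<noteq> t'" for t t'
  proof (rule filterlim_inj_cofinite, rule injI)
    fix i j assume eq: "n i t - n i t' = n j t - n j t'"
    let ?d = "e t - e t'"
    have "?d \<noteq> 0" using e_inj[OF that] by simp
    moreover have "zscale (int (?p ^ i)) ?d = zscale (int (?p ^ j)) ?d"
      using eq by (simp add: n_def zscale_def prod_eq_iff algebra_simps)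
    ultimately have "?p ^ i = ?p ^ j"
      by (cases ?d) (auto simp: zscale_def zero_prod_def simp del: of_nat_power)
    then show "i = j" using p by simp
  qed
  let ?E = "level f 1 1"
  define A where "A t = (if t = 1 then chars f - ?E else if t \<le> ?s then ?E else chars f)" for t :: nat
  have top: "chars f \<in> sets \<mu>" by (rule cylinder_sets[OF H chars_in_cylinders])
  have A_sets: "A t \<in> sets \<mu>" for t
    using top level_sets[OF H, where g = 1 and w = 1] by (auto simp: A_def)
  have A_sub: "A t \<subseteq> chars f" for t by (auto simp: A_def level_def)
  have "joint_event f (n j) {1..r} A = {}" for j
  proof (rule ccontr)
    assume "joint_event f (n j) {1..r} A \<noteq> {}"
    then obtain x where x: "x \<in> chars f" "\<And>t. t \<in> {1..r} \<Longrightarrow> alg_action f (n j t) x \<in> A t"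
      by (auto simp: joint_event_def)
    have "x (coset f (Poly_Mapping.single (zscale (int (?p ^ j)) (e0 1)) 1)) = 1"
    proof (rule frobenius_relation[OF x(1)])
      show "e0 1 \<in> ?S" using s by (intro e0_S) simp
      fix k assume k: "k \<in> ?S" "k \<noteq> e0 1"
      from k(1) have "k \<in> e0 ` {1..?s}" unfolding bij_betw_imp_surj_on[OF e0] .
      then obtain t where t: "k = e0 t" "t \<in> {1..?s}" by (rule imageE)
      then have "t \<noteq> 1" using k(2) by auto
      with t have "A t = ?E" by (simp add: A_def)
      then have "alg_action f (n j t) x \<in> ?E" using x(2)[of t] t(2) r by simp
      then show "x (coset f (Poly_Mapping.single (zscale (int (?p ^ j)) k) 1)) = 1"
        using t by (simp add: level_def alg_action_eval n_def e_def)
    qed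
    then have "alg_action f (n j 1) x \<in> ?E"
      using x(1) s by (simp add: level_def alg_action_closed alg_action_eval n_def e_def)
    moreover have "alg_action f (n j 1) x \<in> A 1" using x(2)[of 1] s r by simp
    ultimately show False by (simp add: A_def)
  qed
  then have empty: "(\<Inter>t\<in>{1..r}. alg_action f (- n j t) ` A t) = {}" for j
    using Inter_action_eq_joint_event[of "{1..r}" A f "n j"] A_sub s r by simp
  have "(\<lambda>j. measure \<mu> (\<Inter>t\<in>{1..r}. alg_action f (- n j t) ` A t)) \<longlonglongrightarrow> (\<Prod>t\<in>{1..r}. measure \<mu> (A t))"
    by (rule mix[unfolded mixing_of_order_def, THEN spec, THEN spec, THEN mp, THEN mp])
       (intro ballI impI n A_sets; assumption)+
  then have "(\<lambda>j::nat. 0::real) \<longlonglongrightarrow> (\<Prod>t\<in>{1..r}. measure \<mu> (A t))" unfolding empty by simp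
  then have "(\<Prod>t\<in>{1..r}. measure \<mu> (A t)) = 0" by (rule LIMSEQ_unique[OF _ tendsto_const])
  then obtain t where t: "measure \<mu> (A t) = 0" by (auto simp: prod_zero_iff)
  have "measure \<mu> (chars f) = 1" using prob_space by (simp add: haar_space[OF H])
  moreover from this have "measure \<mu> (chars f - ?E) = 1 - measure \<mu> ?E"
    using finite_measure_Diff[OF top level_sets[OF H, where g = 1 and w = 1]] by (simp add: level_def)
  ultimately show False using t level_one_measure[OF H f1(1)] unfolding A_def by (auto split: if_splits)
qed

theorem theorem3p1:
  fixes f :: "'p::prime_card laurent"
    and R :: nat
    and \<mu> :: "('p laurent set \<Rightarrow> complex) measure"
  assumes "Factorial_Ring.irreducible f"
    and "is_gon R (newton_polygon f)"
    and "is_haar_prob (dual_group (quot_group f)) (dual_topology (quot_group f)) \<mu>"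
  shows "enat (R - 1) \<le> mixing_order \<mu> (alg_action f) \<and>
         mixing_order \<mu> (alg_action f) < enat (card (Poly_Mapping.keys f))"
proof
  show "enat (R - 1) \<le> mixing_order \<mu> (alg_action f)"
  proof (cases "R \<le> 1")
    case True
    then show ?thesis by (simp flip: zero_enat_def)
  next
    case False
    then have "mixing_of_order \<mu> (alg_action f) (R - 1)"
      by (intro mixing_below_number_of_vertices[OF assms]) auto
    with False show ?thesis unfolding mixing_order_def by (intro Sup_upper) auto
  qed
  have "f \<noteq> 0" using assms(1) by (auto simp: Factorial_Ring.irreducible_def)
  then have s: "0 < card (Poly_Mapping.keys f)" by (simp add: card_gt_0_iff)
  have "mixing_order \<mu> (alg_action f) \<le> enat (card (Poly_Mapping.keys f) - 1)"
    unfolding mixing_order_def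
  proof (rule Sup_least)
    fix y assume "y \<in> {enat r |r. r \<ge> 1 \<and> mixing_of_order \<mu> (alg_action f) r}"
    then obtain r where r: "y = enat r" "mixing_of_order \<mu> (alg_action f) r" by blast
    then have "\<not> card (Poly_Mapping.keys f) \<le> r" using not_mixing_of_order_card_support[OF assms(1,3)] by blast
    then show "y \<le> enat (card (Poly_Mapping.keys f) - 1)" using r(1) by simp
  qed
  also have "\<dots> < enat (card (Poly_Mapping.keys f))" using s by simp
  finally show "mixing_order \<mu> (alg_action f) < enat (card (Poly_Mapping.keys f))" .
qed

end
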